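(* Let $L\subset\mathbb{S}^3$ be a hyperbolic link with a fixed oriented diagram $D$ whose regions carry the variables $w_1,\dots,w_n$, and let $W(w_1,\dots,w_n)$ be the potential function of the diagram. Then the set of equations $$\mathcal{I}=\left\{\exp\left(w_k\frac{\partial W}{\partial w_k}\right)=1\ \middle|\ k=1,\dots,n\right\}$$ becomes the hyperbolicity equations of the five-term triangulation of $\mathbb{S}^3\backslash(L\cup\{\pm\infty\})$. That is, when the tetrahedra of this triangulation are given the shape parameters determined by $(w_1,\dots,w_n)$ (where $(w_1,\dots,w_n)$ is such that all dilogarithm arguments in $W$ lie outside $\{0,1,\infty\}$), the system $\mathcal{I}$ is equivalent to the full system consisting of the gluing equations of all edges together with the completeness condition at all torus cusps.
   Context: **Potential function.** $D$ is an oriented diagram of $L$. Its sides are the arcs connecting two adjacent crossing points, and its regions are the regions surrounded by sides. Assign a complex variable $w_1,\dots,w_n$ to each region. At a crossing, rotate the picture so that both strands point downward, and let $w_j,w_k,w_l,w_m$ be the variables of the bottom, right, top and left regions, respectively. The crossing is positive if the over-strand runs from upper right to lower left, and negative if it runs from upper left to lower right. With $\mathrm{Li}_2(w)=-\int_0^w\frac{\log(1-t)}{t}dt$, the potential function of a positive crossing is $$W_P=-\mathrm{Li}_2\left(\tfrac{w_l}{w_m}\right)-\mathrm{Li}_2\left(\tfrac{w_l}{w_k}\right)+\mathrm{Li}_2\left(\tfrac{w_jw_l}{w_kw_m}\right)+\mathrm{Li}_2\left(\tfrac{w_m}{w_j}\right)+\mathrm{Li}_2\left(\tfrac{w_k}{w_j}\right)-\tfrac{\pi^2}{6}+\log\tfrac{w_m}{w_j}\log\tfrac{w_k}{w_j},$$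 and that of a negative crossing is $W_N=-W_P$ (the same expression with all signs reversed, in the same variables $w_j,w_k,w_l,w_m$). $W(w_1,\dots,w_n)$ is the sum over all crossings. Only values of $(w_1,\dots,w_n)$ for which every argument of a dilogarithm occurring in $W$ lies outside $\{0,1,\infty\}$ are considered. **Octahedral decomposition.** At each crossing $r$ place an octahedron $A_rB_rC_rD_rE_rF_r$ between the two strands, with apex $F_r$ touching the over-strand, apex $E_r$ (below) touching the under-strand, and equatorial vertices $A_r,C_r$ lying along the over-strand and $B_r,D_r$ along the under-strand. Rotate the crossing (ignoring orientation) so that the over-strand runs from lower left to upper right. Then $A_r,B_r,C_r,D_r$ are at the lower left, lower right, upper right and upper left ends, respectively. Let $w_{AB},w_{BC},w_{CD},w_{DA}$ denote the variables of the bottom, right, top and left regions in this position. Identify edge $B_rF_r$ with $D_rF_r$, and $A_rE_r$ with $C_rE_r$. Call $A,C$ vertices of type $-\infty$, $B,D$ vertices of type $\infty$, and $E,F$ apices. At an under-end $X\in\{B_r,D_r\}$ of a crossing, the associated faces are $A_rXE_r$ and $C_rXE_r$. At an over-end $X\in\{A_r,C_r\}$, they are $B_rXF_r$ and $D_rXF_r$. For each side of $D$ joining an end at one crossing to an end at another crossing, glue the two associated faces at one end to the two associated faces at the other end, faces lying on the same side of the arc (in the same region) being glued together, with apex going to apex, type $-\infty$ to type $-\infty$ and type $\infty$ to type $\infty$. All $A_r,C_r$ become one point $-\infty$, all $B_r,D_r$ become one point $\infty$, and the $E_r,F_r$ become points $P_1,\dots,P_s$, one for each component of $L$. Removing all vertices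 gives an ideal decomposition of $\mathbb{S}^3\backslash(L\cup\{\pm\infty\})$ into octahedra. **Five-term triangulation.** Divide each octahedron into the five ideal tetrahedra $A_rB_rD_rF_r$, $B_rC_rD_rF_r$, $A_rB_rC_rD_r$, $A_rB_rC_rE_r$, $A_rC_rD_rE_r$. **Shape parameters.** A shape parameter $u\in\mathbb{C}\backslash\{0,1\}$ assigned to an edge of an ideal tetrahedron is also assigned to the opposite edge. The other edges receive $u'=\frac1{1-u}$ and $u''=1-\frac1u$, so that $u,u',u''$ appear counterclockwise when viewed from an ideal vertex. The assignment is as follows: - edge $A_rF_r$ of $A_rB_rD_rF_r$: $\frac{w_{DA}}{w_{AB}}$; - edge $C_rF_r$ of $B_rC_rD_rF_r$: $\frac{w_{BC}}{w_{CD}}$; - edge $B_rE_r$ of $A_rB_rC_rE_r$: $\frac{w_{BC}}{w_{AB}}$; - edge $D_rE_r$ of $A_rC_rD_rE_r$: $\frac{w_{DA}}{w_{CD}}$; - edges $A_rC_r$ and $B_rD_r$ of $A_rB_rC_rD_r$: $\frac{w_{AB}w_{CD}}{w_{BC}w_{DA}}$. **Hyperbolicity equations.** The gluing equations say that for every edge of the triangulation the product of the shape parameters around that edge is $1$. The completeness condition says that the holonomies induced by the meridian and the longitude of each torus cusp act as translations on the cusp. The hyperbolicity equations are the whole set of these equations. *)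

theory Defs
  imports "HOL-Analysis.Analysis"
begin

section \<open>Link diagrams\<close>

text \<open>
  A crossing is drawn (ignoring orientation) with its over-strand running from lower left to upper
  right.  Its four ends are \<open>A\<close> (lower left), \<open>B\<close> (lower right), \<open>C\<close> (upper right) and
  \<open>D\<close> (upper left), in counterclockwise order.  The over-strand joins \<open>A\<close> and \<open>C\<close>, the
  under-strand joins \<open>B\<close> and \<open>D\<close>.
\<close>

datatype end_pos = A | B | C | D

fun nxt :: "end_pos \<Rightarrow> end_pos" where
  "nxt A = B" | "nxt B = C" | "nxt C = D" | "nxt D = A"

fun prv :: "end_pos \<Rightarrow> end_pos" where
  "prv A = D" | "prv B = A" | "prv C = B" | "prv D = C"

definition over :: "end_pos \<Rightarrow> bool" where
  "over X \<longleftrightarrow> X = A \<or> X = C"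

text \<open>
  A diagram is a set of crossings together with the pairing \<open>mate\<close> of their ends given by the
  sides (arcs between adjacent crossing points) and the set of ends at which the orientation of the
  link leaves the crossing.
\<close>

record 'c diagram =
  crossings :: "'c set"
  mate :: "'c \<times> end_pos \<Rightarrow> 'c \<times> end_pos"
  outgoing :: "'c \<times> end_pos \<Rightarrow> bool"

definition ends :: "'c diagram \<Rightarrow> ('c \<times> end_pos) set" where
  "ends K = crossings K \<times> UNIV"

definition oriented_diagram :: "'c diagram \<Rightarrow> bool" where
  "oriented_diagram K \<longleftrightarrow>
     finite (crossings K) \<and> crossings K \<noteq> {} \<and>
     (\<forall>d\<in>ends K. mate K d \<in> ends K \<and> mate K d \<noteq> d \<and> mate K (mate K d) = d \<and>
        outgoing K (mate K d) = (\<not> outgoing K d)) \<and>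
     (\<forall>c\<in>crossings K. outgoing K (c, C) = (\<not> outgoing K (c, A)) \<and>
        outgoing K (c, D) = (\<not> outgoing K (c, B)))"

text \<open>
  The pair \<open>(c, X)\<close> also stands for the corner at \<open>c\<close> between the end \<open>X\<close> and the next
  end \<open>nxt X\<close>.  A region is the set of its corners, i.e. an orbit of the map taking a corner to the
  following corner of the same region.  (A region has only one boundary walk because a diagram of a
  hyperbolic link is connected.)
\<close>

definition next_corner :: "'c diagram \<Rightarrow> 'c \<times> end_pos \<Rightarrow> 'c \<times> end_pos" where
  "next_corner K d = mate K (fst d, nxt (snd d))"

definition region :: "'c diagram \<Rightarrow> 'c \<times> end_pos \<Rightarrow> ('c \<times> end_pos) set" where
  "region K d = {(next_corner K ^^ n) d | n. True}"

definition regions :: "'c diagram \<Rightarrow> ('c \<times> end_pos) set set" where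
  "regions K = region K ` ends K"

type_synonym 'c region_vars = "('c \<times> end_pos) set \<Rightarrow> complex"


section \<open>Hyperbolic links and their diagrams\<close>

abbreviation S3 :: "(complex \<times> complex) set" where
  "S3 \<equiv> sphere 0 1"

text \<open>Upper half-space model of hyperbolic 3-space, with distance and volume \<open>dx dy dt / t\<^sup>3\<close>.\<close>

definition H3 :: "(complex \<times> real) set" where
  "H3 = {p. snd p > 0}"

definition hyp_dist :: "complex \<times> real \<Rightarrow> complex \<times> real \<Rightarrow> real" where
  "hyp_dist p q = arcosh (1 + (dist p q)\<^sup>2 / (2 * snd p * snd q))"

definition hyp_isometry :: "(complex \<times> real \<Rightarrow> complex \<times> real) \<Rightarrow> bool" where
  "hyp_isometry g \<longleftrightarrow> bij_betw g H3 H3 \<and> (\<forall>p\<in>H3. \<forall>q\<in>H3. hyp_dist (g p) (g q) = hyp_dist p q)"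

text \<open>
  \<open>M\<close> carries a complete hyperbolic structure of finite volume: it is the quotient of \<open>H3\<close> by a
  group of isometries acting as deck transformations, and a set of finite volume covers it.
\<close>

definition hyperbolic_3manifold :: "'a::topological_space set \<Rightarrow> bool" where
  "hyperbolic_3manifold M \<longleftrightarrow>
     (\<exists>p. covering_space H3 p M \<and>
        (\<forall>x\<in>H3. \<forall>y\<in>H3. p x = p y \<longrightarrow>
           (\<exists>g. hyp_isometry g \<and> g x = y \<and> (\<forall>z\<in>H3. p (g z) = p z))) \<and>
        (\<exists>V\<in>sets borel. V \<subseteq> H3 \<and> p ` V = M \<and>
           (\<integral>\<^sup>+q\<in>V. ennreal (1 / snd q ^ 3) \<partial>lborel) < \<infinity>))"

definition is_link :: "(complex \<times> complex) set \<Rightarrow> bool" where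
  "is_link L \<longleftrightarrow> L \<subseteq> S3 \<and> L \<noteq> {} \<and>
     (\<exists>\<C>. finite \<C> \<and> disjoint \<C> \<and> \<Union>\<C> = L \<and>
        (\<forall>J\<in>\<C>. J homeomorphic sphere (0::complex) 1))"

definition hyperbolic_link :: "(complex \<times> complex) set \<Rightarrow> bool" where
  "hyperbolic_link L \<longleftrightarrow> is_link L \<and> hyperbolic_3manifold (S3 - L)"

text \<open>Inverse stereographic projection.\<close>

definition to_S3 :: "complex \<times> real \<Rightarrow> complex \<times> complex" where
  "to_S3 p = (let r = (norm p)\<^sup>2 in
     (of_real (2 / (r + 1)) * fst p, Complex (2 * snd p / (r + 1)) ((r - 1) / (r + 1))))"

definition ambient_isotopic :: "(complex \<times> complex) set \<Rightarrow> (complex \<times> complex) set \<Rightarrow> bool" where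
  "ambient_isotopic L L' \<longleftrightarrow>
     (\<exists>H. continuous_on ({0..1::real} \<times> S3) (\<lambda>(t, x). H t x) \<and>
        (\<forall>t\<in>{0..1}. \<exists>g. homeomorphism S3 S3 (H t) g) \<and>
        (\<forall>x\<in>S3. H 0 x = x) \<and> H 1 ` L = L')"

text \<open>
  \<open>K\<close> is read off from the subset \<open>M\<close> of \<open>\<complex> \<times> \<real>\<close> by projecting to \<open>\<complex>\<close>, the
  second coordinate being the height.  \<open>\<gamma> d\<close> is the lift of the side at the end \<open>d\<close>, running away
  from that crossing.
\<close>

definition projects_to :: "(complex \<times> real) set \<Rightarrow> 'c diagram \<Rightarrow> bool" where
  "projects_to M K \<longleftrightarrow>
     (\<exists>\<gamma> pos hi lo.
        M = (\<Union>d\<in>ends K. \<gamma> d ` {0..1}) \<and>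
        inj_on pos (crossings K) \<and>
        (\<forall>c\<in>crossings K. lo c < (hi c :: real)) \<and>
        (\<forall>d\<in>ends K. path (\<gamma> d) \<and> (\<forall>t\<in>{0..1}. \<gamma> (mate K d) t = \<gamma> d (1 - t)) \<and>
           \<gamma> d 0 = (pos (fst d), if over (snd d) then hi (fst d) else lo (fst d)) \<and>
           inj_on (fst \<circ> \<gamma> d) {0<..<1} \<and>
           (fst \<circ> \<gamma> d) ` {0<..<1} \<inter> pos ` crossings K = {}) \<and>
        (\<forall>d\<in>ends K. \<forall>d'\<in>ends K. d' \<noteq> d \<longrightarrow> d' \<noteq> mate K d \<longrightarrow>
           (fst \<circ> \<gamma> d) ` {0<..<1} \<inter> (fst \<circ> \<gamma> d') ` {0<..<1} = {}) \<and>
        (\<forall>c\<in>crossings K. \<exists>r \<theta>. \<theta> A < \<theta> B \<and> \<theta> B < \<theta> C \<and> \<theta> C < \<theta> D \<and> \<theta> D < \<theta> A + 2 * pi \<and>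
           (\<forall>X. r X > 0 \<and> ((fst \<circ> \<gamma> (c, X)) has_vector_derivative of_real (r X) * cis (\<theta> X))
                             (at 0 within {0..1}))))"

definition diagram_of :: "'c diagram \<Rightarrow> (complex \<times> complex) set \<Rightarrow> bool" where
  "diagram_of K L \<longleftrightarrow> oriented_diagram K \<and>
     (\<exists>M. projects_to M K \<and> ambient_isotopic L (to_S3 ` M))"


section \<open>The potential function\<close>

text \<open>
  The dilogarithm and the logarithm are multivalued.  \<open>dilog_along \<gamma>\<close> is the value of
  \<open>- (integral of log (1 - t) / t)\<close> along a path \<open>\<gamma>\<close> from 0, with \<open>log (1 - t)\<close> continued along
  \<open>\<gamma>\<close> from its value 0 at the start.
\<close>

definition log_one_minus_along :: "(real \<Rightarrow> complex) \<Rightarrow> real \<Rightarrow> complex" where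
  "log_one_minus_along \<gamma> = (SOME l. continuous_on {0..1} l \<and> l 0 = 0 \<and>
     (\<forall>t\<in>{0..1}. exp (l t) = 1 - \<gamma> t))"

definition dilog_along :: "(real \<Rightarrow> complex) \<Rightarrow> complex" where
  "dilog_along \<gamma> = - integral {0..1}
     (\<lambda>t. log_one_minus_along \<gamma> t / \<gamma> t * vector_derivative \<gamma> (at t within {0..1}))"

text \<open>Local branches near the point \<open>a\<close>.\<close>

definition dilog_branch :: "complex \<Rightarrow> (complex \<Rightarrow> complex) \<Rightarrow> bool" where
  "dilog_branch a f \<longleftrightarrow>
     (\<exists>\<gamma> e. 0 < e \<and> ball a e \<inter> {0, 1} = {} \<and>
        valid_path \<gamma> \<and> pathstart \<gamma> = 0 \<and> pathfinish \<gamma> = a \<and> (\<forall>t\<in>{0<..1}. \<gamma> t \<notin> {0, 1}) \<and>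
        (\<forall>z\<in>ball a e. f z = dilog_along (\<gamma> +++ linepath a z)))"

definition log_branch :: "complex \<Rightarrow> (complex \<Rightarrow> complex) \<Rightarrow> bool" where
  "log_branch a f \<longleftrightarrow>
     (\<exists>e>0. continuous_on (ball a e) f \<and> (\<forall>z\<in>ball a e. exp (f z) = z))"

definition dilog_args :: "complex \<Rightarrow> complex \<Rightarrow> complex \<Rightarrow> complex \<Rightarrow> complex list" where
  "dilog_args j k l m = [l / m, l / k, (j * l) / (k * m), m / j, k / j]"

text \<open>
  The potential \<open>W\<^sub>P\<close> of a positive crossing.  Each occurrence of the dilogarithm (\<open>li 0\<close>, ...,
  \<open>li 4\<close>) and of the logarithm (\<open>lg 0\<close>, \<open>lg 1\<close>) may have its own branch.
\<close>

definition potential_P ::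
  "(nat \<Rightarrow> complex \<Rightarrow> complex) \<Rightarrow> (nat \<Rightarrow> complex \<Rightarrow> complex) \<Rightarrow>
     complex \<Rightarrow> complex \<Rightarrow> complex \<Rightarrow> complex \<Rightarrow> complex" where
  "potential_P li lg j k l m =
     - li 0 (l / m) - li 1 (l / k) + li 2 ((j * l) / (k * m)) + li 3 (m / j) + li 4 (k / j)
     - of_real (pi\<^sup>2 / 6) + lg 0 (m / j) * lg 1 (k / j)"

text \<open>
  When both strands of a crossing point downward, the bottom corner is the one between the two
  outgoing ends; the right, top and left corners follow counterclockwise.  The lower left end is then
  the clockwise end of the bottom corner, and the crossing is positive if it lies on the over-strand.
\<close>

definition bottom :: "'c diagram \<Rightarrow> 'c \<Rightarrow> end_pos" where
  "bottom K c = (THE X. outgoing K (c, X) \<and> outgoing K (c, nxt X))"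

definition positive :: "'c diagram \<Rightarrow> 'c \<Rightarrow> bool" where
  "positive K c \<longleftrightarrow> over (bottom K c)"

definition wj :: "'c diagram \<Rightarrow> 'c region_vars \<Rightarrow> 'c \<Rightarrow> complex" where
  "wj K w c = w (region K (c, bottom K c))"

definition wk :: "'c diagram \<Rightarrow> 'c region_vars \<Rightarrow> 'c \<Rightarrow> complex" where
  "wk K w c = w (region K (c, nxt (bottom K c)))"

definition wl :: "'c diagram \<Rightarrow> 'c region_vars \<Rightarrow> 'c \<Rightarrow> complex" where
  "wl K w c = w (region K (c, nxt (nxt (bottom K c))))"

definition wm :: "'c diagram \<Rightarrow> 'c region_vars \<Rightarrow> 'c \<Rightarrow> complex" where
  "wm K w c = w (region K (c, nxt (nxt (nxt (bottom K c)))))"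

text \<open>
  All dilogarithm arguments lie outside \<open>{0, 1, \<infinity>}\<close>.  Since \<open>x / 0 = 0\<close>, a vanishing denominator
  is excluded together with the value 0.
\<close>

definition admissible :: "'c diagram \<Rightarrow> 'c region_vars \<Rightarrow> bool" where
  "admissible K w \<longleftrightarrow>
     (\<forall>c\<in>crossings K.
        \<forall>x\<in>set (dilog_args (wj K w c) (wk K w c) (wl K w c) (wm K w c)). x \<noteq> 0 \<and> x \<noteq> 1)"

text \<open>\<open>W\<close> is a branch near \<open>w\<close> of the potential function of the diagram.\<close>

definition potential_function ::
  "'c diagram \<Rightarrow> 'c region_vars \<Rightarrow> ('c region_vars \<Rightarrow> complex) \<Rightarrow> bool" where
  "potential_function K w W \<longleftrightarrow>
     (\<exists>li lg.
        (\<forall>c\<in>crossings K.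
           (\<forall>i<5. dilog_branch (dilog_args (wj K w c) (wk K w c) (wl K w c) (wm K w c) ! i) (li c i)) \<and>
           log_branch (wm K w c / wj K w c) (lg c 0) \<and>
           log_branch (wk K w c / wj K w c) (lg c 1)) \<and>
        W = (\<lambda>v. \<Sum>c\<in>crossings K. (if positive K c then 1 else - 1) *
               potential_P (li c) (lg c) (wj K v c) (wk K v c) (wl K v c) (wm K v c)))"

definition potential_equations ::
  "'c diagram \<Rightarrow> ('c region_vars \<Rightarrow> complex) \<Rightarrow> 'c region_vars \<Rightarrow> bool" where
  "potential_equations K W w \<longleftrightarrow>
     (\<forall>k\<in>regions K. exp (w k * deriv (\<lambda>z. W (w(k := z))) (w k)) = 1)"


section \<open>The five-term triangulation\<close>

text \<open>
  Vertices of the octahedron at a crossing: the equatorial ones lie at the four ends, the apex \<open>F\<close>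
  is above and the apex \<open>E\<close> below.
\<close>

datatype oct_vertex = Eq end_pos | E | F

datatype ideal_type = Minus_Infinity | Plus_Infinity | Apex

fun vtype :: "oct_vertex \<Rightarrow> ideal_type" where
  "vtype (Eq X) = (if over X then Minus_Infinity else Plus_Infinity)"
| "vtype E = Apex"
| "vtype F = Apex"

definition apex :: "end_pos \<Rightarrow> oct_vertex" where
  "apex X = (if over X then F else E)"

text \<open>
  The faces associated with an end \<open>X\<close>, in the regions clockwise and counterclockwise of \<open>X\<close> as
  seen from the crossing.  A region lying clockwise of one end of a side lies counterclockwise of the
  other end.
\<close>

definition cw_face :: "end_pos \<Rightarrow> oct_vertex set" where
  "cw_face X = {Eq (prv X), Eq X, apex X}"

definition ccw_face :: "end_pos \<Rightarrow> oct_vertex set" where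
  "ccw_face X = {Eq X, Eq (nxt X), apex X}"

definition glued :: "'c diagram \<Rightarrow> (('c \<times> oct_vertex set) \<times> ('c \<times> oct_vertex set)) set" where
  "glued K = {((c, ccw_face X), (c', cw_face X')) | c X c' X'.
                c \<in> crossings K \<and> mate K (c, X) = (c', X')}"

definition face_pairing :: "'c diagram \<Rightarrow> (('c \<times> oct_vertex set) \<times> ('c \<times> oct_vertex set)) set" where
  "face_pairing K = glued K \<union> (glued K)\<inverse>"

datatype tet = ABDF | BCDF | ABCD | ABCE | ACDE

text \<open>
  The vertices \<open>(a, b, p, q)\<close> of each tetrahedron are listed so that \<open>b, p, q\<close> appear
  counterclockwise when viewed from \<open>a\<close>.  For \<open>ABCD\<close> the edge \<open>BD\<close> passes above \<open>AC\<close>.  The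
  listing starts with an edge \<open>ab\<close> to which \<open>shape_param\<close> below assigns its parameter.
\<close>

fun tet_vertices :: "tet \<Rightarrow> oct_vertex \<times> oct_vertex \<times> oct_vertex \<times> oct_vertex" where
  "tet_vertices ABDF = (F, Eq A, Eq B, Eq D)"
| "tet_vertices BCDF = (F, Eq C, Eq D, Eq B)"
| "tet_vertices ABCD = (Eq A, Eq C, Eq B, Eq D)"
| "tet_vertices ABCE = (E, Eq B, Eq A, Eq C)"
| "tet_vertices ACDE = (E, Eq D, Eq C, Eq A)"

definition verts :: "tet \<Rightarrow> oct_vertex set" where
  "verts \<tau> = (case tet_vertices \<tau> of (a, b, p, q) \<Rightarrow> {a, b, p, q})"

definition tet_edges :: "tet \<Rightarrow> oct_vertex set set" where
  "tet_edges \<tau> = {e. e \<subseteq> verts \<tau> \<and> card e = 2}"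

fun shape_param :: "'c diagram \<Rightarrow> 'c region_vars \<Rightarrow> 'c \<Rightarrow> tet \<Rightarrow> complex" where
  "shape_param K w c ABDF = w (region K (c, D)) / w (region K (c, A))"
| "shape_param K w c BCDF = w (region K (c, B)) / w (region K (c, C))"
| "shape_param K w c ABCE = w (region K (c, B)) / w (region K (c, A))"
| "shape_param K w c ACDE = w (region K (c, D)) / w (region K (c, C))"
| "shape_param K w c ABCD = (w (region K (c, A)) * w (region K (c, C))) /
                            (w (region K (c, B)) * w (region K (c, D)))"

definition shape :: "'c diagram \<Rightarrow> 'c region_vars \<Rightarrow> 'c \<Rightarrow> tet \<Rightarrow> oct_vertex set \<Rightarrow> complex" where
  "shape K w c \<tau> e = (let u = shape_param K w c \<tau> in
     case tet_vertices \<tau> of (a, b, p, q) \<Rightarrow>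
       if e = {a, b} \<or> e = {p, q} then u
       else if e = {a, p} \<or> e = {b, q} then 1 / (1 - u)
       else 1 - 1 / u)"

text \<open>
  Edges of the octahedra and of their tetrahedra, identified by the face pairing and by
  \<open>BF = DF\<close>, \<open>AE = CE\<close>.
\<close>

definition edge_ident :: "'c diagram \<Rightarrow> (('c \<times> oct_vertex set) \<times> ('c \<times> oct_vertex set)) set" where
  "edge_ident K =
     {((c, e), (c', e')) | c e c' e'. \<exists>f f'. ((c, f), (c', f')) \<in> face_pairing K \<and>
        e \<subseteq> f \<and> e' \<subseteq> f' \<and> card e = 2 \<and> card e' = 2 \<and> vtype ` e = vtype ` e'} \<union>
     {((c, {Eq B, F}), (c, {Eq D, F})) | c. c \<in> crossings K} \<union>
     {((c, {Eq A, E}), (c, {Eq C, E})) | c. c \<in> crossings K}"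

definition edge_class :: "'c diagram \<Rightarrow> 'c \<times> oct_vertex set \<Rightarrow> ('c \<times> oct_vertex set) set" where
  "edge_class K x = {y. (x, y) \<in> (edge_ident K \<union> (edge_ident K)\<inverse>)\<^sup>*}"

definition triangulation_edges :: "'c diagram \<Rightarrow> ('c \<times> oct_vertex set) set set" where
  "triangulation_edges K = {edge_class K (c, e) | c e \<tau>. c \<in> crossings K \<and> e \<in> tet_edges \<tau>}"

definition gluing_equations :: "'c diagram \<Rightarrow> 'c region_vars \<Rightarrow> bool" where
  "gluing_equations K w \<longleftrightarrow>
     (\<forall>Q\<in>triangulation_edges K.
        (\<Prod>(c, \<tau>, e)\<in>{(c, \<tau>, e). c \<in> crossings K \<and> e \<in> tet_edges \<tau> \<and> (c, e) \<in> Q}.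
           shape K w c \<tau> e) = 1)"


section \<open>Holonomy of the torus cusps\<close>

text \<open>
  The cusp section at an ideal vertex is triangulated by the links of the corners of the tetrahedra.
  A flag \<open>(c, \<tau>, x, a, b)\<close> describes a curve entering the triangle of the tetrahedron \<open>\<tau>\<close> of \<open>c\<close>
  at its vertex \<open>x\<close> through the face \<open>xab\<close>; the edge \<open>xa\<close> is on the left and \<open>xb\<close> on the
  right when viewed from \<open>x\<close>.  The relation below passes from a face of \<open>(c, \<tau>)\<close> to the same
  face seen in the adjacent tetrahedron.
\<close>

type_synonym 'c flag = "'c \<times> tet \<times> oct_vertex \<times> oct_vertex \<times> oct_vertex"

fun adjacent :: "'c diagram \<Rightarrow> 'c flag \<Rightarrow> 'c flag \<Rightarrow> bool" where
  "adjacent K (c, \<tau>, x, a, b) (c', \<tau>', x', a', b') \<longleftrightarrow>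
     {x, a, b} \<subseteq> verts \<tau> \<and> {x', a', b'} \<subseteq> verts \<tau>' \<and>
     (c' = c \<and> \<tau>' \<noteq> \<tau> \<and> x' = x \<and> a' = a \<and> b' = b \<or>
      ((c, {x, a, b}), (c', {x', a', b'})) \<in> face_pairing K \<and>
      vtype x' = vtype x \<and> vtype a' = vtype a \<and> vtype b' = vtype b)"

text \<open>
  \<open>develops K w s ts s' h\<close>: the curve that starts at the flag \<open>s\<close> and turns successively as told
  by \<open>ts\<close> arrives at \<open>s'\<close>, and \<open>h\<close> is the derivative of its developing map.  In each triangle the
  side by which the curve leaves, oriented from left to right, is the side by which it enters rotated
  about their common vertex: multiplied by the shape parameter there for a left turn, divided by it
  for a right turn.
\<close>

datatype turn = Left_Turn | Right_Turn

inductive develops ::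
  "'c diagram \<Rightarrow> 'c region_vars \<Rightarrow> 'c flag \<Rightarrow> turn list \<Rightarrow> 'c flag \<Rightarrow> complex \<Rightarrow> bool"
  for K w where
  stop: "develops K w s [] s 1"
| left: "develops K w (c, \<tau>, x, a, b) (Left_Turn # ts) s'' (shape K w c \<tau> {x, a} * h)"
    if "distinct [x, a, b, y]" "verts \<tau> = {x, a, b, y}" "adjacent K (c, \<tau>, x, a, y) s'"
       "develops K w s' ts s'' h"
| right: "develops K w (c, \<tau>, x, a, b) (Right_Turn # ts) s'' (h / shape K w c \<tau> {x, b})"
    if "distinct [x, a, b, y]" "verts \<tau> = {x, a, b, y}" "adjacent K (c, \<tau>, x, y, b) s'"
       "develops K w s' ts s'' h"

text \<open>
  The holonomy of a closed curve is the similarity \<open>z \<mapsto> h z + t\<close> with \<open>h\<close> as above.  It is a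
  translation iff \<open>h = 1\<close>.
\<close>

definition acts_as_translation ::
  "'c diagram \<Rightarrow> 'c region_vars \<Rightarrow> 'c flag \<Rightarrow> turn list \<Rightarrow> bool" where
  "acts_as_translation K w s ts \<longleftrightarrow> develops K w s ts s 1"

text \<open>
  Base points on the torus cusps are taken at the sides leading from an over-end to an under-end;
  the second one, which is an incoming end \<open>(c, X)\<close>, represents the side.  As no component of a
  hyperbolic link passes only over or only under, every torus cusp has such a side, and different
  sides of one component give freely homotopic curves.  The base point lies on the link of the face
  \<open>cw_face X\<close>, to the left of the strand.
\<close>

definition cusp_bases :: "'c diagram \<Rightarrow> ('c \<times> end_pos) set" where
  "cusp_bases K =
     {d \<in> ends K. \<not> outgoing K d \<and> \<not> over (snd d) \<and> over (snd (mate K d))}"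

definition base_flag :: "'c \<times> end_pos \<Rightarrow> 'c flag" where
  "base_flag d = (case d of (c, X) \<Rightarrow>
     (c, if X = B then ABCE else ACDE, E, Eq X, Eq (prv X)))"

text \<open>
  The meridian turns about the edge \<open>XE\<close> of the octahedron ahead to the right-hand face, goes back
  into the octahedron behind, and there turns about the edge from \<open>F\<close> to the outgoing over-end, to
  the left-hand face again.  Thus it encircles the side.
\<close>

definition meridian :: "turn list" where
  "meridian = [Left_Turn, Right_Turn]"

text \<open>
  The longitude is the parallel of the component on the left of the diagram.  At each passage it goes
  through two triangles, turning about the end to the left of the strand; this end is on the left as
  seen from the apex \<open>F\<close> (over-passages) and on the right as seen from \<open>E\<close> (under-passages).  Any
  other choice of framing multiplies the longitude by a power of the meridian, which also has to act
  as a translation.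
\<close>

definition next_passage :: "'c diagram \<Rightarrow> 'c \<times> end_pos \<Rightarrow> 'c \<times> end_pos" where
  "next_passage K d = mate K (fst d, nxt (nxt (snd d)))"

definition passages :: "'c diagram \<Rightarrow> 'c \<times> end_pos \<Rightarrow> nat" where
  "passages K d = (LEAST n. 0 < n \<and> (next_passage K ^^ n) d = d)"

definition longitude :: "'c diagram \<Rightarrow> 'c \<times> end_pos \<Rightarrow> turn list" where
  "longitude K d = concat (map (\<lambda>i. if over (snd ((next_passage K ^^ i) d))
     then [Left_Turn, Left_Turn] else [Right_Turn, Right_Turn]) [0..<passages K d])"

definition completeness :: "'c diagram \<Rightarrow> 'c region_vars \<Rightarrow> bool" where
  "completeness K w \<longleftrightarrow>
     (\<forall>d\<in>cusp_bases K.
        acts_as_translation K w (base_flag d) meridian \<and>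
        acts_as_translation K w (base_flag d) (longitude K d))"

definition hyperbolicity_equations :: "'c diagram \<Rightarrow> 'c region_vars \<Rightarrow> bool" where
  "hyperbolicity_equations K w \<longleftrightarrow> gluing_equations K w \<and> completeness K w"

end

theory Submission
  imports Defs "HOL-Complex_Analysis.Cauchy_Integral_Formula"
begin

text \<open>
  Both systems of equations reduce to the same conditions, one for each region of the diagram: the
  product of certain rational factors over the corners of the region equals 1.

  On the side of the potential function, every branch of the dilogarithm satisfies
  \<open>z Li\<^sub>2'(z) = - log (1 - z)\<close> for some value of the logarithm (\<open>dilog_branch_derivative\<close>).  Hence
  \<open>exp (w\<^sub>k \<partial>W / \<partial>w\<^sub>k)\<close> no longer involves the branches and is a product of rational functions, one for
  each corner at which the region meets a crossing (\<open>potential_equations_iff\<close>).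

  On the side of the triangulation, an edge joining \<open>-\<infinity>\<close> to \<open>\<infinity>\<close> along the equator of an octahedron
  belongs to a corner, and gluing identifies precisely the equatorial edges of the corners of one region
  (\<open>corner_edge_class\<close>).  The product of the shape parameters at such an edge within one octahedron is
  the corner factor of the potential function (\<open>shapes_around_corner_edge\<close>, \<open>crossing_potential\<close>).  The
  diagonals \<open>AC\<close> and \<open>BD\<close> have product 1 within one octahedron.  The edges at the apices contribute, at
  each end of a strand, the ratio of the two adjacent regions; since these two regions are exchanged when
  a side is viewed from its other end, all these contributions cancel (\<open>prod_around_class\<close>).  Thus the
  gluing equations are the equations of the regions (\<open>gluing_equations_iff\<close>).

  The completeness condition holds for all admissible variables (\<open>completeness_holds\<close>).  The meridian
  encircles a side and turns about its two ends, with inverse ratios.  During a passage the longitude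
  acquires a factor depending on the regions at the entry divided by the same expression for the entry of
  the next passage, so its holonomy telescopes to 1 along the closed component.
\<close>

section \<open>Branches of the dilogarithm and the logarithm\<close>

text \<open>
  In a disc avoiding 1 this quotient differs from 1 by less than 1, so its principal logarithm is
  holomorphic there.
\<close>

lemma log_one_minus_ratio:
  assumes "ball a r \<subseteq> - {1 :: complex}" "z \<in> ball a r" "r > 0"
  shows "(1 - z) / (1 - a) \<notin> \<real>\<^sub>\<le>\<^sub>0"
proof -
  have "a \<noteq> 1" using assms by auto
  have "r \<le> dist a 1" using assms(1) by (meson ComplD insertI1 linorder_not_less mem_ball subsetD)
  then have "dist a z < norm (1 - a)"
    using assms(2) by (simp add: dist_norm norm_minus_commute)
  moreover have "(1 - z) / (1 - a) - 1 = (a - z) / (1 - a)"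
    using \<open>a \<noteq> 1\<close> by (simp add: field_simps)
  ultimately have "norm ((1 - z) / (1 - a) - 1) < 1"
    using \<open>a \<noteq> 1\<close> by (simp add: norm_divide dist_norm)
  then have "\<bar>Re ((1 - z) / (1 - a)) - 1\<bar> < 1"
    by (smt (verit, best) abs_Re_le_cmod minus_complex.simps(1) one_complex.simps(1))
  then show ?thesis by (auto simp: complex_nonpos_Reals_iff)
qed

text \<open>
  Near \<open>a\<close> the germ of \<open>log (1 - z)\<close> with value \<open>u\<close> at \<open>a\<close> is \<open>u + Ln ((1 - z) / (1 - a))\<close>.  The
  quotient by \<open>z\<close> is holomorphic for \<open>a \<noteq> 0\<close>; for \<open>a = 0\<close> the singularity at 0 is removable because
  the germ with \<open>u = 0\<close> vanishes there.  A holomorphic function on a disc has a primitive.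
\<close>

lemma dilog_local_primitive:
  fixes a u :: complex
  assumes "a \<noteq> 1" "a = 0 \<Longrightarrow> u = 0"
  obtains r H where "r > 0" "ball a r \<subseteq> - {1}" "\<And>z. z \<in> ball a r \<Longrightarrow> H field_differentiable at z"
    "\<And>z. z \<in> ball a r \<Longrightarrow> z \<noteq> 0 \<Longrightarrow>
       (H has_field_derivative (u + Ln ((1 - z) / (1 - a))) / z) (at z)"
proof -
  define r where "r = (if a = 0 then 1 else min (norm (1 - a)) (norm a))"
  define q where "q = (\<lambda>z. u + Ln ((1 - z) / (1 - a)))"
  define g where "g = (\<lambda>z. if z = 0 then deriv q 0 else q z / z)"
  have r: "r > 0" "ball a r \<subseteq> - {1}"
    using assms by (auto simp: r_def dist_norm norm_minus_commute)
  have hq: "q holomorphic_on ball a r"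
    unfolding q_def using assms(1)
    by (intro holomorphic_intros log_one_minus_ratio[OF r(2) _ r(1)]) auto
  have "g holomorphic_on ball a r"
  proof (cases "a = 0")
    case True
    then have "q 0 = 0" using assms by (simp add: q_def)
    then show ?thesis
      using pole_lemma_open[OF hq open_ball, of 0] by (simp add: g_def cong: if_cong)
  next
    case False
    then have nz: "z \<noteq> 0" if "z \<in> ball a r" for z
      using that by (auto simp: r_def)
    have "(\<lambda>z. q z / z) holomorphic_on ball a r"
      using nz by (intro holomorphic_intros hq) auto
    then show ?thesis
      by (rule holomorphic_transform) (use nz in \<open>auto simp: g_def\<close>)
  qed
  then obtain H where H: "\<And>z. z \<in> ball a r \<Longrightarrow> (H has_field_derivative g z) (at z within ball a r)"
    using holomorphic_convex_primitive'[OF convex_ball open_ball] by blast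
  then have H': "(H has_field_derivative g z) (at z)" if "z \<in> ball a r" for z
    using that by (metis at_within_open open_ball)
  show thesis
  proof (rule that[OF r])
    show "H field_differentiable at z" if "z \<in> ball a r" for z
      using H'[OF that] field_differentiable_def by blast
    show "(H has_field_derivative (u + Ln ((1 - z) / (1 - a))) / z) (at z)"
      if "z \<in> ball a r" "z \<noteq> 0" for z
      using H'[OF that(1)] that(2) by (simp add: g_def q_def)
  qed
qed

lemma continuous_log_near:
  fixes l :: "real \<Rightarrow> complex"
  assumes "continuous_on S l" "t0 \<in> S"
  obtains e where "e > 0" "\<And>t. t \<in> S \<Longrightarrow> dist t t0 < e \<Longrightarrow> l t = l t0 + Ln (exp (l t) / exp (l t0))"
proof -
  obtain e where e: "e > 0" "\<And>t. t \<in> S \<Longrightarrow> dist t t0 < e \<Longrightarrow> dist (l t) (l t0) < pi"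
    using assms pi_gt_zero unfolding continuous_on_iff by blast
  have "l t = l t0 + Ln (exp (l t) / exp (l t0))" if "t \<in> S" "dist t t0 < e" for t
  proof -
    have "\<bar>Im (l t - l t0)\<bar> < pi"
      using e(2)[OF that] abs_Im_le_cmod[of "l t - l t0"] by (simp add: dist_norm)
    then have "Ln (exp (l t - l t0)) = l t - l t0"
      by (intro Ln_exp) (auto simp: abs_less_iff)
    then show ?thesis by (simp add: exp_diff)
  qed
  then show ?thesis using that e(1) by blast
qed

lemma has_vector_derivative_C1:
  assumes "p C1_differentiable_on ({0..1} - T)" "t \<in> {0..1} - T"
  shows "(p has_vector_derivative vector_derivative p (at t within {0..1})) (at t)"
proof -
  have d: "p differentiable at t"
    using assms C1_differentiable_on_eq by blast
  have "vector_derivative p (at t within {0..1}) = vector_derivative p (at t)"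
    using vector_derivative_at_within_ivl[of p "vector_derivative p (at t)" t 0 1]
      d assms(2) vector_derivative_works by auto
  then show ?thesis using d vector_derivative_works by metis
qed

text \<open>
  A piecewise \<open>C\<^sup>1\<close> path may have an unbounded derivative near its break points, so integrability does
  not follow from boundedness.  It is obtained locally from the fundamental theorem of calculus: near
  each parameter the integrand is the derivative of a primitive composed with the path, including at
  the start of the path, where \<open>p\<close> vanishes.
\<close>

lemma dilog_integrand_integrable:
  fixes p :: "real \<Rightarrow> complex" and l :: "real \<Rightarrow> complex"
  assumes p: "valid_path p" "\<And>t. t \<in> {0..1} \<Longrightarrow> p t \<noteq> 1" "\<And>t. t \<in> {0<..1} \<Longrightarrow> p t \<noteq> 0"
    and l: "continuous_on {0..1} l" "l 0 = 0" "\<And>t. t \<in> {0..1} \<Longrightarrow> exp (l t) = 1 - p t"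
  shows "(\<lambda>t. l t / p t * vector_derivative p (at t within {0..1})) integrable_on {0..1}"
proof -
  let ?f = "\<lambda>t. l t / p t * vector_derivative p (at t within {0..1})"
  have cp: "continuous_on {0..1} p"
    using p(1) valid_path_def piecewise_C1_differentiable_on_def by blast
  obtain T where T: "finite T" "p C1_differentiable_on ({0..1} - T)"
    using p(1) unfolding valid_path_def piecewise_C1_differentiable_on_def by blast
  have p0: "t = 0" if "t \<in> {0..1}" "p t = 0" for t
    using that p(3)[of t] by fastforce
  have loc: "\<exists>d>0. \<forall>u v. x \<in> cbox u v \<and> cbox u v \<subseteq> ball x d \<and> cbox u v \<subseteq> cbox 0 1 \<longrightarrow>
      ?f integrable_on cbox u v" if x: "x \<in> cbox 0 1" for x
  proof -
    have x': "x \<in> {0..1}" using x by simp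
    have "l x = 0" if "p x = 0" using p0[OF x' that] l(2) by simp
    then obtain r H where r: "r > 0" "ball (p x) r \<subseteq> - {1}"
      and Hd: "\<And>z. z \<in> ball (p x) r \<Longrightarrow> H field_differentiable at z"
      and H: "\<And>z. z \<in> ball (p x) r \<Longrightarrow> z \<noteq> 0 \<Longrightarrow>
         (H has_field_derivative (l x + Ln ((1 - z) / (1 - p x))) / z) (at z)"
      using dilog_local_primitive[OF p(2)[OF x'], of "l x"] by metis
    obtain e1 where e1: "e1 > 0"
        "\<And>t. t \<in> {0..1} \<Longrightarrow> dist t x < e1 \<Longrightarrow> l t = l x + Ln (exp (l t) / exp (l x))"
      using continuous_log_near[OF l(1) x'] by metis
    obtain e2 where e2: "e2 > 0" "\<And>t. t \<in> {0..1} \<Longrightarrow> dist t x < e2 \<Longrightarrow> dist (p t) (p x) < r"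
      using cp x' r(1) unfolding continuous_on_iff by blast
    have "?f integrable_on cbox u v"
      if uv: "x \<in> cbox u v" "cbox u v \<subseteq> ball x (min e1 e2)" "cbox u v \<subseteq> cbox 0 1" for u v
    proof -
      have pt: "p t \<in> ball (p x) r" if "t \<in> {u..v}" for t
        using e2(2)[of t] uv(2,3) that by (auto simp: dist_commute subset_iff)
      have lt: "l t = l x + Ln ((1 - p t) / (1 - p x))" if "t \<in> {u..v}" for t
        using e1(2)[of t] uv(2,3) that l(3)[of t] l(3)[OF x'] by (auto simp: dist_commute subset_iff)
      have sub: "{u..v} \<subseteq> {0..1}" using uv(3) by simp
      have "(?f has_integral ((H \<circ> p) v - (H \<circ> p) u)) {u..v}"
      proof (rule fundamental_theorem_of_calculus_interior_strong[of "insert 0 T"])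
        show "finite (insert 0 T)" using T by simp
        show "u \<le> v" using uv(1) by simp
        show "continuous_on {u..v} (H \<circ> p)"
        proof (rule continuous_on_compose)
          show "continuous_on {u..v} p" using cp sub continuous_on_subset by blast
          show "continuous_on (p ` {u..v}) H"
            using Hd pt by (intro continuous_at_imp_continuous_on)
              (auto intro!: field_differentiable_imp_continuous_at)
        qed
        fix t assume t: "t \<in> {u<..<v} - insert 0 T"
        then have t': "t \<in> {u..v}" "t \<in> {0..1} - T" "p t \<noteq> 0"
          using sub p0[of t] by auto
        have "((H \<circ> p) has_vector_derivative vector_derivative p (at t within {0..1}) *
            ((l x + Ln ((1 - p t) / (1 - p x))) / p t)) (at t)"
          by (intro field_vector_diff_chain_at has_vector_derivative_C1[OF T(2) t'(2)] H pt t')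
        then show "((H \<circ> p) has_vector_derivative ?f t) (at t)"
          using lt[OF t'(1)] by (simp add: mult.commute)
      qed
      then show ?thesis by (auto simp: integrable_on_def)
    qed
    then show ?thesis using e1(1) e2(1) by (intro exI[of _ "min e1 e2"]) auto
  qed
  show ?thesis
    using integrable_on_little_subintervals[of 0 1 ?f] loc by auto
qed

lemma log_one_minus_along_spec:
  assumes "continuous_on {0..1} p" "p 0 = 0" "\<And>t. t \<in> {0..1} \<Longrightarrow> p t \<noteq> 1"
  shows "continuous_on {0..1} (log_one_minus_along p)" "log_one_minus_along p 0 = 0"
    "\<And>t. t \<in> {0..1} \<Longrightarrow> exp (log_one_minus_along p t) = 1 - p t"
proof -
  have "contractible {0..1::real}" by (simp add: convex_imp_contractible)
  moreover have "continuous_on {0..1} (\<lambda>t. 1 - p t)" by (intro continuous_intros assms)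
  ultimately obtain g where g: "continuous_on {0..1} g" "\<And>t. t \<in> {0..1} \<Longrightarrow> 1 - p t = exp (g t)"
    using continuous_logarithm_on_contractible[of "{0..1}" "\<lambda>t. 1 - p t"] assms(3) by (metis right_minus_eq)
  have "exp (g 0) = 1" using g(2)[of 0] assms(2) by simp
  then have "\<exists>l. continuous_on {0..1} l \<and> l 0 = 0 \<and> (\<forall>t\<in>{0..1}. exp (l t) = 1 - p t)"
    by (intro exI[of _ "\<lambda>t. g t - g 0"]) (auto intro!: continuous_intros g(1) simp: g(2) exp_diff)
  from someI_ex[OF this] show "continuous_on {0..1} (log_one_minus_along p)" "log_one_minus_along p 0 = 0"
    "\<And>t. t \<in> {0..1} \<Longrightarrow> exp (log_one_minus_along p t) = 1 - p t"
    unfolding log_one_minus_along_def by auto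
qed

text \<open>
  The logarithm along a path is only specified by a choice operator.  This uniqueness determines its
  values and makes them independent of the part of the path traversed later.
\<close>

lemma continuous_logs_agree:
  fixes l l' :: "real \<Rightarrow> complex"
  assumes "continuous_on {s..t} l" "continuous_on {s..t} l'" "l s = l' s"
    "\<And>x. x \<in> {s..t} \<Longrightarrow> exp (l x) = exp (l' x)" "x \<in> {s..t}"
  shows "l x = l' x"
proof -
  let ?g = "\<lambda>x. (l x - l' x) / (2 * pi * \<i>)"
  have Z: "?g x \<in> \<int>" if x: "x \<in> {s..t}" for x
  proof -
    obtain n :: int where "l x = l' x + of_int (2 * n) * pi * \<i>"
      using assms(4)[OF x] exp_eq by blast
    then have "?g x = of_int n" by (simp add: field_simps)
    then show ?thesis by simp
  qed
  have "?g constant_on {s..t}"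
  proof (rule continuous_discrete_range_constant)
    show "connected {s..t}" by simp
    show "continuous_on {s..t} ?g" by (intro continuous_intros assms) auto
    fix x assume x: "x \<in> {s..t}"
    show "\<exists>e>0. \<forall>y. y \<in> {s..t} \<and> ?g y \<noteq> ?g x \<longrightarrow> e \<le> norm (?g y - ?g x)"
    proof (intro exI[of _ 1] conjI allI impI)
      fix y assume "y \<in> {s..t} \<and> ?g y \<noteq> ?g x"
      then have "?g y - ?g x \<in> \<int>" "?g y - ?g x \<noteq> 0" using Z x by (blast intro: Ints_diff, simp)
      then obtain n where "?g y - ?g x = of_int n" "n \<noteq> 0" by (metis Ints_cases of_int_0)
      then show "1 \<le> norm (?g y - ?g x)" by simp
    qed simp
  qed
  moreover have "s \<in> {s..t}" using assms(5) by auto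
  ultimately have "?g x = ?g s" using assms(5) unfolding constant_on_def by metis
  then show ?thesis using assms(3) by simp
qed

lemma log_branch_derivative:
  assumes "log_branch a f"
  shows "exp (f a) = a" "(f has_field_derivative 1 / a) (at a)"
proof -
  obtain e where e: "e > 0" "continuous_on (ball a e) f" "\<And>z. z \<in> ball a e \<Longrightarrow> exp (f z) = z"
    using assms unfolding log_branch_def by blast
  show ea: "exp (f a) = a" using e by simp
  have a0: "a \<noteq> 0" using ea exp_not_eq_zero by metis
  have "isCont f a" using e(1,2) by (simp add: continuous_on_eq_continuous_at)
  then have "(exp has_field_derivative a) (at (f a)) \<Longrightarrow> (f has_field_derivative inverse a) (at a)"
    using e a0 by (intro has_field_derivative_inverse_basic[where f = exp and t = "ball a e"]) auto
  then show "(f has_field_derivative 1 / a) (at a)"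
    using DERIV_exp[of "f a"] ea by (simp add: inverse_eq_divide)
qed

text \<open>
  The integral along the path to \<open>a\<close> followed by the segment from \<open>a\<close> to \<open>z\<close> splits at parameter 1/2:
  the first part does not depend on \<open>z\<close>, and the second is an increment of the local primitive.  The value of the
  logarithm reached at \<open>a\<close> depends on the path, but only up to multiples of \<open>2 \<pi> \<i>\<close>.
\<close>

lemma dilog_branch_derivative:
  assumes "dilog_branch a f"
  obtains L where "exp L = 1 - a" "(f has_field_derivative - L / a) (at a)"
proof -
  obtain \<gamma> e where e: "0 < e" "ball a e \<inter> {0, 1} = {}"
    and \<gamma>: "valid_path \<gamma>" "pathstart \<gamma> = 0" "pathfinish \<gamma> = a" "\<And>t. t \<in> {0<..1} \<Longrightarrow> \<gamma> t \<notin> {0, 1}"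
    and f: "\<And>z. z \<in> ball a e \<Longrightarrow> f z = dilog_along (\<gamma> +++ linepath a z)"
    using assms unfolding dilog_branch_def by metis
  have a: "a \<noteq> 0" "a \<noteq> 1" using e by auto
  define p where "p = (\<lambda>z. \<gamma> +++ linepath a z)"
  define l where "l = (\<lambda>z. log_one_minus_along (p z))"
  define integrand where "integrand = (\<lambda>z t. l z t / p z t * vector_derivative (p z) (at t within {0..1}))"
  have line: "linepath a z t \<in> ball a e" if "z \<in> ball a e" "t \<in> {0..1}" for z t
  proof -
    have "linepath a z t \<in> closed_segment a z" using that linepath_in_path by blast
    then show ?thesis using that e(1) by (meson centre_in_ball closed_segment_subset convex_ball subsetD)
  qed
  have vp: "valid_path (p z)" for z
    unfolding p_def using \<gamma> by (intro valid_path_join) auto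
  have pn: "p z t \<noteq> 1" "t > 0 \<Longrightarrow> p z t \<noteq> 0" if "z \<in> ball a e" "t \<in> {0..1}" for z t
  proof -
    have "\<gamma> 0 = 0" using \<gamma>(2) by (simp add: pathstart_def)
    then have "\<gamma> s \<noteq> 1" if "s \<in> {0..1}" for s using \<gamma>(4)[of s] that by (cases "s = 0") auto
    moreover have "linepath a z s \<notin> {0, 1}" if "s \<in> {0..1}" for s
      using line[OF \<open>z \<in> ball a e\<close> that] e(2) by blast
    ultimately show "p z t \<noteq> 1" "t > 0 \<Longrightarrow> p z t \<noteq> 0"
      using that \<gamma>(4)[of "2 * t"] by (auto simp: p_def joinpaths_def)
  qed
  have p0: "p z 0 = 0" for z using \<gamma>(2) by (simp add: p_def joinpaths_def pathstart_def)
  have ph: "p z (1/2) = a" for z using \<gamma>(3) by (simp add: p_def joinpaths_def pathfinish_def)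
  have cp: "continuous_on {0..1} (p z)" for z
    using vp valid_path_imp_path path_def by blast
  have l: "continuous_on {0..1} (l z)" "l z 0 = 0" "\<And>t. t \<in> {0..1} \<Longrightarrow> exp (l z t) = 1 - p z t"
    if "z \<in> ball a e" for z
    using log_one_minus_along_spec[OF cp p0 pn(1)[OF that]] unfolding l_def by auto
  have int: "integrand z integrable_on {0..1}" if "z \<in> ball a e" for z
    unfolding integrand_def by (rule dilog_integrand_integrable[OF vp _ _ l[OF that]]) (use pn[OF that] in auto)
  have ae: "a \<in> ball a e" using e by simp
  define u where "u = l a (1/2)"
  have eu: "exp u = 1 - a" using l(3)[OF ae, of "1/2"] ph by (simp add: u_def)
  have lu: "l z t = l a t" if z: "z \<in> ball a e" and t: "t \<in> {0..1/2}" for z t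
  proof (rule continuous_logs_agree[OF _ _ _ _ t])
    show "continuous_on {0..1/2} (l z)" "continuous_on {0..1/2} (l a)"
      using l(1)[OF z] l(1)[OF ae] by (auto elim: continuous_on_subset)
    show "l z 0 = l a 0" using l(2)[OF z] l(2)[OF ae] by simp
    show "exp (l z s) = exp (l a s)" if "s \<in> {0..1/2}" for s
      using that l(3)[OF z, of s] l(3)[OF ae, of s] by (simp add: p_def joinpaths_def)
  qed
  obtain r H where r: "r > 0" "ball a r \<subseteq> - {1}"
    and H: "\<And>z. z \<in> ball a r \<Longrightarrow> z \<noteq> 0 \<Longrightarrow>
       (H has_field_derivative (u + Ln ((1 - z) / (1 - a))) / z) (at z)"
    using dilog_local_primitive[of a u] a by metis
  define d where "d = min e r"
  have d: "d > 0" "ball a d \<subseteq> ball a e" "ball a d \<subseteq> ball a r" using e r by (auto simp: d_def)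
  define head where "head = integral {0..1/2} (integrand a)"
  have fz: "f z = - head - (H z - H a)" if z: "z \<in> ball a d" for z
  proof -
    have ze: "z \<in> ball a e" and zr: "z \<in> ball a r" using z d by auto
    have lin: "linepath a z t \<in> ball a r" "linepath a z t \<noteq> 0" if "t \<in> {0..1}" for t
    proof -
      have "linepath a z t \<in> closed_segment a z" using that linepath_in_path by blast
      then have "linepath a z t \<in> ball a d"
        using z d(1) by (meson centre_in_ball closed_segment_subset convex_ball subsetD)
      then show "linepath a z t \<in> ball a r" "linepath a z t \<noteq> 0"
        using d(2,3) e(2) by (blast, metis disjoint_iff insertCI subsetD)
    qed
    have first: "integral {0..1/2} (integrand z) = head" unfolding head_def
    proof (rule integral_spike[of "{1/2}"])
      fix t assume t: "t \<in> {0..1/2} - {1/2::real}"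
      have ev: "eventually (\<lambda>s. s \<in> {0..1} \<longrightarrow> p z s = p a s) (nhds t)"
        by (rule eventually_mono[OF eventually_nhds_in_open[of "{..<1/2}"]])
          (use t in \<open>auto simp: p_def joinpaths_def\<close>)
      have "vector_derivative (p z) (at t within {0..1}) = vector_derivative (p a) (at t within {0..1})"
        using ev t by (intro vector_derivative_cong_eq) auto
      then show "integrand a t = integrand z t"
        using t lu[OF ze, of t] by (simp add: integrand_def p_def joinpaths_def)
    qed simp
    have pz: "p z s = linepath a z (2 * s - 1)" if "s \<in> {1/2..1}" for s
    proof (cases "s = 1/2")
      case True
      then show ?thesis by (simp only: ph) (simp add: linepath_def)
    qed (use that in \<open>auto simp: p_def joinpaths_def\<close>)
    have lt: "l z t = u + Ln ((1 - p z t) / (1 - a))" if t: "t \<in> {1/2..1}" for t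
    proof (rule continuous_logs_agree[OF _ _ _ _ t])
      have rat: "(1 - p z s) / (1 - a) \<notin> \<real>\<^sub>\<le>\<^sub>0" if "s \<in> {1/2..1}" for s
        using log_one_minus_ratio[OF r(2) _ r(1)] lin(1)[of "2 * s - 1"] pz[OF that] that by auto
      show "continuous_on {1/2..1} (l z)" using l(1)[OF ze] by (auto elim: continuous_on_subset)
      have "continuous_on {1/2..1} (p z)" using cp by (rule continuous_on_subset) auto
      then show "continuous_on {1/2..1} (\<lambda>t. u + Ln ((1 - p z t) / (1 - a)))"
        using rat a by (intro continuous_intros) auto
      show "l z (1/2) = u + Ln ((1 - p z (1/2)) / (1 - a))"
        using ph lu[OF ze, of "1/2"] a by (simp add: u_def)
      show "exp (l z s) = exp (u + Ln ((1 - p z s) / (1 - a)))" if s: "s \<in> {1/2..1}" for s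
        using l(3)[OF ze, of s] pn(1)[OF ze, of s] s a eu by (simp add: exp_add)
    qed
    have "(integrand z has_integral ((H \<circ> p z) 1 - (H \<circ> p z) (1/2))) {1/2..1}"
    proof (rule fundamental_theorem_of_calculus_interior_strong[of "{}"])
      show "continuous_on {1/2..1} (H \<circ> p z)"
      proof (rule continuous_on_compose)
        show "continuous_on {1/2..1} (p z)" using cp by (rule continuous_on_subset) auto
        show "continuous_on (p z ` {1/2..1}) H"
          using DERIV_isCont[OF H] lin by (intro continuous_at_imp_continuous_on) (auto simp: pz)
      qed
      fix t :: real assume t: "t \<in> {1/2<..<1} - {}"
      have "((\<lambda>s. linepath a z (2 * s - 1)) has_vector_derivative 2 * (z - a)) (at t)"
        by (auto simp: linepath_def scaleR_conv_of_real algebra_simps intro!: derivative_eq_intros)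
      then have pd: "(p z has_vector_derivative 2 * (z - a)) (at t)"
        using t by (elim has_vector_derivative_transform_within_open[of _ _ _ "{1/2<..<1}"]) (auto simp: pz)
      have "vector_derivative (p z) (at t within {0..1}) = 2 * (z - a)"
        using vector_derivative_at_within_ivl[OF pd, of 0 1] t by auto
      moreover have "((H \<circ> p z) has_vector_derivative 2 * (z - a) * ((u + Ln ((1 - p z t) / (1 - a))) / p z t)) (at t)"
        using t lin[of "2 * t - 1"] pz[of t] by (intro field_vector_diff_chain_at pd H) auto
      ultimately show "((H \<circ> p z) has_vector_derivative integrand z t) (at t)"
        using lt[of t] t by (simp add: integrand_def mult.commute)
    qed auto
    then have second: "integral {1/2..1} (integrand z) = H z - H a"
      using ph by (auto simp: integral_unique p_def joinpaths_def linepath_def)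
    have "integral {0..1} (integrand z) = integral {0..1/2} (integrand z) + integral {1/2..1} (integrand z)"
      using Henstock_Kurzweil_Integration.integral_combine[of 0 "1/2" 1 "integrand z"] int[OF ze] by simp
    then show ?thesis
      using f[OF ze] first second by (simp add: dilog_along_def integrand_def l_def p_def)
  qed
  have "((\<lambda>z. - head - (H z - H a)) has_field_derivative - u / a) (at a)"
    using H[of a] r a by (auto intro!: derivative_eq_intros)
  then have "(f has_field_derivative - u / a) (at a)"
    by (rule has_field_derivative_transform_within_open[of _ _ _ "ball a d"]) (use d fz in auto)
  with eu show thesis using that by blast
qed

section \<open>Ends, corners and regions of a diagram\<close>

lemma nxt_prv [simp]: "nxt (prv X) = X" "prv (nxt X) = X"
  by (cases X; simp)+

lemma over_nxt_prv [simp]: "over (nxt X) \<longleftrightarrow> \<not> over X" "over (prv X) \<longleftrightarrow> \<not> over X"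
  by (cases X; simp add: over_def)+

lemma UNIV_end_pos: "UNIV = {A, B, C, D}"
proof -
  have "X \<in> {A, B, C, D}" for X by (cases X) auto
  then show ?thesis by blast
qed

lemma UNIV_tet: "UNIV = {ABDF, BCDF, ABCD, ABCE, ACDE}"
proof -
  have "\<tau> \<in> {ABDF, BCDF, ABCD, ABCE, ACDE}" for \<tau> by (cases \<tau>) auto
  then show ?thesis by blast
qed

lemma funpow_returns:
  assumes "finite S" "\<And>x. x \<in> S \<Longrightarrow> f x \<in> S" "inj_on f S" "x \<in> S"
  obtains n where "n > 0" "(f ^^ n) x = x"
proof -
  have in_S: "(f ^^ n) x \<in> S" for n
    using assms(2,4) by (induction n) auto
  have "\<not> inj (\<lambda>n. (f ^^ n) x)"
    using assms(1) in_S by (meson finite_subset image_subsetI range_inj_infinite)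
  then obtain i j where "i < j" "(f ^^ i) x = (f ^^ j) x"
    by (metis injI linorder_neqE_nat)
  moreover have "(f ^^ (n - i)) x = x" if "i \<le> n" "(f ^^ i) x = (f ^^ n) x" for i n
    using that
  proof (induction i arbitrary: n)
    case (Suc i)
    then obtain m where m: "n = Suc m" "i \<le> m" by (cases n) auto
    have "(f ^^ i) x = (f ^^ m) x"
      using Suc.prems(2) m in_S assms(3) by (simp add: inj_on_eq_iff)
    then show ?case using Suc.IH[of m] m by simp
  qed simp
  ultimately show thesis using that[of "j - i"] by simp
qed

locale link_diagram =
  fixes K :: "'c diagram"
  assumes oriented: "oriented_diagram K"
begin

lemma finite_crossings: "finite (crossings K)"
  using oriented unfolding oriented_diagram_def by blast

lemma finite_ends: "finite (ends K)"
  unfolding ends_def UNIV_end_pos using finite_crossings by simp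

lemma mate:
  assumes "d \<in> ends K"
  shows "mate K d \<in> ends K" "mate K (mate K d) = d" "outgoing K (mate K d) \<longleftrightarrow> \<not> outgoing K d"
  using assms oriented unfolding oriented_diagram_def by auto

lemma in_ends [simp]: "(c, X) \<in> ends K \<longleftrightarrow> c \<in> crossings K"
  by (simp add: ends_def)

lemma next_corner_in_ends: "d \<in> ends K \<Longrightarrow> next_corner K d \<in> ends K"
  unfolding next_corner_def by (intro mate) (cases d; simp)

lemma inj_on_next_corner: "inj_on (next_corner K) (ends K)"
proof (rule inj_onI)
  fix d d' assume d: "d \<in> ends K" "d' \<in> ends K" "next_corner K d = next_corner K d'"
  then have "(fst d, nxt (snd d)) = (fst d', nxt (snd d'))"
    unfolding next_corner_def by (metis in_ends mate(2) prod.collapse)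
  then show "d = d'" by (metis nxt_prv(2) prod.collapse prod.inject)
qed

lemma region_next_corner:
  assumes "d \<in> ends K"
  shows "region K (next_corner K d) = region K d"
proof -
  obtain n where n: "n > 0" "(next_corner K ^^ n) d = d"
    using funpow_returns[OF finite_ends next_corner_in_ends inj_on_next_corner assms] by blast
  have "(next_corner K ^^ m) (next_corner K d) = (next_corner K ^^ Suc m) d" for m
    by (simp add: funpow_swap1)
  moreover have "\<exists>m'. (next_corner K ^^ m) d = (next_corner K ^^ Suc m') d" for m
  proof (cases m)
    case 0
    then show ?thesis using n by (intro exI[of _ "n - 1"]) simp
  qed auto
  ultimately show ?thesis unfolding region_def by (intro Collect_cong) metis
qed

lemma self_in_region: "d \<in> region K d"
  unfolding region_def by (auto intro!: exI[of _ 0])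

text \<open>
  The region clockwise of one end of a side is counterclockwise of the other end.  All cancellations
  below come from this exchange.
\<close>

lemma region_across_side:
  assumes "c \<in> crossings K" "mate K (c, X) = (c', X')"
  shows "region K (c', prv X') = region K (c, X)" "region K (c', X') = region K (c, prv X)"
proof -
  have c': "c' \<in> crossings K" "mate K (c', X') = (c, X)"
    using mate[of "(c, X)"] assms by auto
  show "region K (c', prv X') = region K (c, X)"
    using region_next_corner[of "(c', prv X')"] c' by (simp add: next_corner_def)
  show "region K (c', X') = region K (c, prv X)"
    using region_next_corner[of "(c, prv X)"] assms by (simp add: next_corner_def)
qed

text \<open>
  Each side joins an outgoing end to an incoming one, so the factors cancel in pairs.  The involution
  alone would only show that the square of the product is 1; the orientation removes the sign.
\<close>

lemma prod_over_sides_cancels: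
  fixes g :: "'c \<times> end_pos \<Rightarrow> complex"
  assumes P: "\<And>d. d \<in> ends K \<Longrightarrow> P (mate K d) = P d"
    and g: "\<And>d. d \<in> ends K \<Longrightarrow> g d * g (mate K d) = 1"
  shows "(\<Prod>d\<in>ends K. if P d then g d else 1) = 1"
proof -
  let ?h = "\<lambda>d. if P d then g d else 1"
  let ?out = "{d \<in> ends K. outgoing K d}" and ?in = "{d \<in> ends K. \<not> outgoing K d}"
  have "prod ?h (ends K) = prod ?h ?out * prod ?h ?in"
  proof -
    have "ends K = ?out \<union> ?in" "?out \<inter> ?in = {}" by auto
    then show ?thesis using prod.union_disjoint[of ?out ?in ?h] finite_ends by simp
  qed
  also have "prod ?h ?in = prod (?h \<circ> mate K) ?out"
    by (rule prod.reindex_bij_witness[of _ "mate K" "mate K"]) (auto simp: mate)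
  also have "prod ?h ?out * prod (?h \<circ> mate K) ?out = (\<Prod>d\<in>?out. 1)"
    unfolding prod.distrib[symmetric] by (rule prod.cong) (auto simp: P g)
  finally show ?thesis by simp
qed

end

section \<open>Shape parameters around the edges of one octahedron\<close>

definition corner_edge :: "end_pos \<Rightarrow> oct_vertex set" where
  "corner_edge X = {Eq X, Eq (nxt X)}"

text \<open>
  The two faces associated with an end contain edges from its apex to vertices of type \<open>\<infinity>\<close> and to
  vertices of type \<open>-\<infinity>\<close>; those of equal type are identified.  The representatives below are chosen
  such that every edge at an apex is \<open>plus_edge X\<close> or \<open>minus_edge X\<close> of exactly one end \<open>X\<close>.  A product over
  these edges thereby becomes a product over ends.
\<close>

definition plus_edge :: "end_pos \<Rightarrow> oct_vertex set" where
  "plus_edge X = (if over X then {Eq (nxt X), F} else {Eq X, E})"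

definition minus_edge :: "end_pos \<Rightarrow> oct_vertex set" where
  "minus_edge X = (if over X then {Eq X, F} else {Eq (prv X), E})"

definition octahedron_edges :: "oct_vertex set set" where
  "octahedron_edges = {{Eq A, Eq B}, {Eq B, Eq C}, {Eq C, Eq D}, {Eq D, Eq A}, {Eq A, Eq C}, {Eq B, Eq D},
     {Eq A, F}, {Eq B, F}, {Eq C, F}, {Eq D, F}, {Eq A, E}, {Eq B, E}, {Eq C, E}, {Eq D, E}}"

lemma two_element_subsets:
  assumes "distinct [a, b, p, q]"
  shows "{e. e \<subseteq> {a, b, p, q} \<and> card e = 2} = {{a, b}, {a, p}, {a, q}, {b, p}, {b, q}, {p, q}}" (is "?L = ?R")
proof
  show "?R \<subseteq> ?L" using assms by auto
  show "?L \<subseteq> ?R"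
  proof
    fix e assume "e \<in> ?L"
    then obtain x y where e: "e = {x, y}" "x \<noteq> y" "x \<in> {a, b, p, q}" "y \<in> {a, b, p, q}"
      unfolding card_2_iff by auto
    show "e \<in> ?R"
      unfolding e(1) using e(2-) by (elim insertE emptyE; simp add: insert_commute)
  qed
qed

lemma tet_edges_eq:
  "tet_edges ABDF = {{F, Eq A}, {F, Eq B}, {F, Eq D}, {Eq A, Eq B}, {Eq A, Eq D}, {Eq B, Eq D}}"
  "tet_edges BCDF = {{F, Eq C}, {F, Eq D}, {F, Eq B}, {Eq C, Eq D}, {Eq C, Eq B}, {Eq D, Eq B}}"
  "tet_edges ABCD = {{Eq A, Eq C}, {Eq A, Eq B}, {Eq A, Eq D}, {Eq C, Eq B}, {Eq C, Eq D}, {Eq B, Eq D}}"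
  "tet_edges ABCE = {{E, Eq B}, {E, Eq A}, {E, Eq C}, {Eq B, Eq A}, {Eq B, Eq C}, {Eq A, Eq C}}"
  "tet_edges ACDE = {{E, Eq D}, {E, Eq C}, {E, Eq A}, {Eq D, Eq C}, {Eq D, Eq A}, {Eq C, Eq A}}"
  by (simp_all add: tet_edges_def verts_def two_element_subsets)

lemma tet_edges_subset: "tet_edges \<tau> \<subseteq> octahedron_edges"
  by (cases \<tau>; simp add: tet_edges_eq octahedron_edges_def insert_commute)

text \<open>
  The conditions under which the five shape parameters of the crossing avoid 0 and 1.
\<close>

definition nondegenerate :: "'c diagram \<Rightarrow> 'c region_vars \<Rightarrow> 'c \<Rightarrow> bool" where
  "nondegenerate K w c \<longleftrightarrow>
     (\<forall>X. w (region K (c, X)) \<noteq> 0 \<and> w (region K (c, X)) \<noteq> w (region K (c, nxt X))) \<and>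
     w (region K (c, A)) * w (region K (c, C)) \<noteq> w (region K (c, B)) * w (region K (c, D))"

text \<open>
  The arguments are the variables of the four corners of a crossing in counterclockwise order.
\<close>

definition quad_factor :: "complex \<Rightarrow> complex \<Rightarrow> complex \<Rightarrow> complex \<Rightarrow> complex" where
  "quad_factor x n y p = (1 - x / p) * (1 - x / n) / (1 - (x * y) / (n * p))"

text \<open>
  A quarter turn exchanges the over-strand and the under-strand and inverts the expression for the
  product of the shape parameters at an equatorial edge; this is the source of the two cases.
\<close>

definition corner_factor :: "'c diagram \<Rightarrow> 'c region_vars \<Rightarrow> 'c \<Rightarrow> end_pos \<Rightarrow> complex" where
  "corner_factor K w c X =
     (let v = (\<lambda>Y. w (region K (c, Y))); f = quad_factor (v X) (v (nxt X)) (v (nxt (nxt X))) (v (prv X))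
      in if over X then f else 1 / f)"

definition shapes_around :: "'c diagram \<Rightarrow> 'c region_vars \<Rightarrow> 'c \<Rightarrow> oct_vertex set \<Rightarrow> complex" where
  "shapes_around K w c e = (\<Prod>\<tau>\<in>UNIV. if e \<in> tet_edges \<tau> then shape K w c \<tau> e else 1)"

lemma prod_tet: "prod g (UNIV :: tet set) = g ABDF * g BCDF * g ABCD * g ABCE * (g ACDE :: complex)"
  by (simp add: UNIV_tet)

lemma prod_end_pos: "prod g (UNIV :: end_pos set) = g A * g B * g C * (g D :: complex)"
  by (simp add: UNIV_end_pos)

lemma shape_in_tet:
  "(if e \<in> tet_edges \<tau> then shape K w c \<tau> e else 1) =
   (if e \<subseteq> verts \<tau> \<and> card e = 2 then shape K w c \<tau> e else 1)"
  by (simp add: tet_edges_def)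

lemma nondegenerateD:
  assumes "nondegenerate K w c" "a = w (region K (c, A))" "b = w (region K (c, B))"
    "c' = w (region K (c, C))" "d = w (region K (c, D))"
  shows "a \<noteq> 0" "b \<noteq> 0" "c' \<noteq> 0" "d \<noteq> 0" "a \<noteq> b" "b \<noteq> c'" "c' \<noteq> d" "d \<noteq> a" "a * c' \<noteq> b * d"
proof -
  have "w (region K (c, X)) \<noteq> 0" "w (region K (c, X)) \<noteq> w (region K (c, nxt X))" for X
    using assms(1) unfolding nondegenerate_def by auto
  note * = this[of A] this[of B] this[of C] this[of D]
  show "a \<noteq> 0" "b \<noteq> 0" "c' \<noteq> 0" "d \<noteq> 0" "a \<noteq> b" "b \<noteq> c'" "c' \<noteq> d" "d \<noteq> a"
    using * unfolding nxt.simps assms(2-) by blast+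
  show "a * c' \<noteq> b * d"
    using assms(1) unfolding nondegenerate_def assms(2-) by blast
qed

lemma shapes_around_corner_edge: "shapes_around K w c (corner_edge X) = corner_factor K w c X"
  unfolding shapes_around_def prod_tet shape_in_tet corner_edge_def
  by (cases X; simp add: verts_def shape_def doubleton_eq_iff corner_factor_def quad_factor_def over_def mult.commute)

text \<open>
  The diagonals of the equator impose no condition.  The edges \<open>BF\<close>, \<open>DF\<close> are identified, as are \<open>AE\<close>,
  \<open>CE\<close>, so only the product of each pair matters; it is the product of the ratios of the adjacent
  regions at the two ends of the strand concerned.
\<close>

lemma shapes_around_other_edges:
  assumes "nondegenerate K w c" "a = w (region K (c, A))" "b = w (region K (c, B))"
    "c' = w (region K (c, C))" "d = w (region K (c, D))"
  shows "shapes_around K w c {Eq A, Eq C} = 1" "shapes_around K w c {Eq B, Eq D} = 1"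
    "shapes_around K w c {Eq A, F} = d / a" "shapes_around K w c {Eq C, F} = b / c'"
    "shapes_around K w c {Eq B, E} = b / a" "shapes_around K w c {Eq D, E} = d / c'"
    "shapes_around K w c {Eq B, F} * shapes_around K w c {Eq D, F} = (a * c') / (b * d)"
    "shapes_around K w c {Eq A, E} * shapes_around K w c {Eq C, E} = (a * c') / (b * d)"
proof -
  note nz = nondegenerateD[OF assms]
  show "shapes_around K w c {Eq A, Eq C} = 1" "shapes_around K w c {Eq B, Eq D} = 1"
    unfolding shapes_around_def prod_tet shape_in_tet using nz by (simp_all add: verts_def shape_def doubleton_eq_iff flip: assms(2-))
  show "shapes_around K w c {Eq A, F} = d / a" "shapes_around K w c {Eq C, F} = b / c'"
    "shapes_around K w c {Eq B, E} = b / a" "shapes_around K w c {Eq D, E} = d / c'"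
    unfolding shapes_around_def prod_tet shape_in_tet using nz by (simp_all add: verts_def shape_def doubleton_eq_iff flip: assms(2-))
  have *: "1 / (1 - x / y) * (1 - y / x) = - y / x" if "x \<noteq> 0" "y \<noteq> 0" "x \<noteq> y" for x y :: complex
    using that by (simp add: divide_simps) algebra
  have "shapes_around K w c {Eq B, F} * shapes_around K w c {Eq D, F} =
      (1 / (1 - d / a) * (1 - a / d)) * (1 / (1 - b / c') * (1 - c' / b))"
    unfolding shapes_around_def prod_tet shape_in_tet by (simp add: verts_def shape_def doubleton_eq_iff flip: assms(2-))
  also have "\<dots> = (a * c') / (b * d)"
    unfolding *[OF nz(4,1,8)] *[OF nz(2,3,6)] by simp
  finally show "shapes_around K w c {Eq B, F} * shapes_around K w c {Eq D, F} = (a * c') / (b * d)" .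
  have "shapes_around K w c {Eq A, E} * shapes_around K w c {Eq C, E} =
      (1 / (1 - b / a) * (1 - a / b)) * (1 / (1 - d / c') * (1 - c' / d))"
    unfolding shapes_around_def prod_tet shape_in_tet by (simp add: verts_def shape_def doubleton_eq_iff flip: assms(2-))
  also have "\<dots> = (a * c') / (b * d)"
    unfolding *[OF nz(2,1) nz(5)[symmetric]] *[OF nz(4,3) nz(7)[symmetric]] by simp
  finally show "shapes_around K w c {Eq A, E} * shapes_around K w c {Eq C, E} = (a * c') / (b * d)" .
qed

section \<open>Edge classes and gluing equations\<close>

lemma prod_octahedron_edges:
  fixes g :: "oct_vertex set \<Rightarrow> complex"
  shows "prod g octahedron_edges =
    (\<Prod>X\<in>UNIV. g (corner_edge X)) * (g {Eq A, Eq C} * g {Eq B, Eq D}) *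
    (g {Eq A, F} * g {Eq C, F} * (g {Eq B, F} * g {Eq D, F})) *
    (g {Eq B, E} * g {Eq D, E} * (g {Eq A, E} * g {Eq C, E}))"
  unfolding octahedron_edges_def prod_end_pos corner_edge_def
  by (simp add: doubleton_eq_iff)

text \<open>
  The contributions of the edges at the apices are distributed to the four ends.  The result is a ratio
  of the two regions adjacent to the end, of the same form for over-ends and under-ends, which is what
  makes the contributions of the two ends of a side inverse to each other.
\<close>

lemma crossing_product:
  assumes "nondegenerate K w c"
    and q: "q {Eq B, F} = q {Eq D, F}" "q {Eq A, E} = q {Eq C, E}"
    and v: "\<And>X. v X = w (region K (c, X))"
  shows "(\<Prod>e\<in>octahedron_edges. if q e then shapes_around K w c e else 1) =
    (\<Prod>X\<in>UNIV. if q (corner_edge X) then corner_factor K w c X else 1) *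
    (\<Prod>X\<in>UNIV. if q (plus_edge X) then v X / v (prv X) else 1) *
    (\<Prod>X\<in>UNIV. if q (minus_edge X) then v (prv X) / v X else 1)"
proof -
  define a b c' d where abcd: "a = v A" "b = v B" "c' = v C" "d = v D"
  note ar = shapes_around_other_edges[OF assms(1) abcd[unfolded v]]
  let ?g = "\<lambda>e. if q e then shapes_around K w c e else 1"
  have 1: "?g {Eq A, Eq C} * ?g {Eq B, Eq D} = 1"
    by (simp add: ar)
  have 2: "?g {Eq B, F} * ?g {Eq D, F} = (if q {Eq B, F} then (a * c') / (b * d) else 1)"
    using ar(7) q by simp
  have 3: "?g {Eq A, E} * ?g {Eq C, E} = (if q {Eq A, E} then (a * c') / (b * d) else 1)"
    using ar(8) q by simp
  have "prod ?g octahedron_edges = (\<Prod>X\<in>UNIV. if q (corner_edge X) then corner_factor K w c X else 1) *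
    ((if q {Eq A, F} then d / a else 1) * (if q {Eq C, F} then b / c' else 1) *
       (if q {Eq B, F} then (a * c') / (b * d) else 1)) *
    ((if q {Eq B, E} then b / a else 1) * (if q {Eq D, E} then d / c' else 1) *
       (if q {Eq A, E} then (a * c') / (b * d) else 1))"
    unfolding prod_octahedron_edges 1 2 3 by (simp only: shapes_around_corner_edge ar mult_1_right cong: if_cong)
  moreover have "(\<Prod>X\<in>UNIV. if q (plus_edge X) then v X / v (prv X) else 1) =
     (if q {Eq B, E} then b / a else 1) * (if q {Eq D, E} then d / c' else 1) *
       (if q {Eq B, F} then (a * c') / (b * d) else 1)"
    unfolding prod_end_pos plus_edge_def by (simp add: over_def q abcd mult_ac)
  moreover have "(\<Prod>X\<in>UNIV. if q (minus_edge X) then v (prv X) / v X else 1) =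
     (if q {Eq A, F} then d / a else 1) * (if q {Eq C, F} then b / c' else 1) *
       (if q {Eq A, E} then (a * c') / (b * d) else 1)"
    unfolding prod_end_pos minus_edge_def by (simp add: over_def q abcd mult_ac)
  ultimately show ?thesis by (simp only: mult_ac)
qed

lemma edge_class_step:
  assumes "(x, y) \<in> edge_ident K"
  shows "x \<in> edge_class K z \<longleftrightarrow> y \<in> edge_class K z"
  using assms unfolding edge_class_def by (auto intro: rtrancl_into_rtrancl)

lemma edge_class_self: "x \<in> edge_class K x"
  by (simp add: edge_class_def)

lemma edge_class_sym_trans: "y \<in> edge_class K x \<Longrightarrow> edge_class K y = edge_class K x"
proof -
  let ?R = "(edge_ident K \<union> (edge_ident K)\<inverse>)\<^sup>*"
  have "sym ?R" by (intro sym_rtrancl sym_Un_converse)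
  moreover assume "y \<in> edge_class K x"
  ultimately show ?thesis
    unfolding edge_class_def by (intro Collect_cong) (metis mem_Collect_eq rtrancl_trans symD)
qed

lemma corner_edge_inject [simp]: "corner_edge X = corner_edge Y \<longleftrightarrow> X = Y"
  by (cases X; cases Y; simp add: corner_edge_def doubleton_eq_iff)

lemma card_corner_edge: "card (corner_edge X) = 2"
  by (cases X) (auto simp: corner_edge_def)

lemma vtype_corner_edge: "vtype ` corner_edge X = {Minus_Infinity, Plus_Infinity}"
  by (cases X) (auto simp: corner_edge_def over_def)

text \<open>
  A face associated with an end has vertices of all three types, hence exactly one edge joining types
  \<open>-\<infinity>\<close> and \<open>\<infinity>\<close>.
\<close>

lemma corner_edge_of_face:
  assumes "card e = 2" "vtype ` e = {Minus_Infinity, Plus_Infinity}"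
  shows "e \<subseteq> ccw_face X \<Longrightarrow> e = corner_edge X" "e \<subseteq> cw_face X \<Longrightarrow> e = corner_edge (prv X)"
proof -
  have "apex X \<notin> e"
  proof
    assume "apex X \<in> e"
    then have "vtype (apex X) \<in> {Minus_Infinity, Plus_Infinity}" using assms(2) by blast
    then show False by (simp add: apex_def split: if_splits)
  qed
  moreover have "e = corner_edge Y" if "e \<subseteq> corner_edge Y" for Y
    using that assms(1) card_corner_edge[of Y] by (intro card_subset_eq) (auto simp: corner_edge_def)
  moreover have "e \<subseteq> ccw_face X \<Longrightarrow> apex X \<notin> e \<Longrightarrow> e \<subseteq> corner_edge X"
    "e \<subseteq> cw_face X \<Longrightarrow> apex X \<notin> e \<Longrightarrow> e \<subseteq> corner_edge (prv X)"
    unfolding ccw_face_def cw_face_def corner_edge_def by auto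
  ultimately show "e \<subseteq> ccw_face X \<Longrightarrow> e = corner_edge X" "e \<subseteq> cw_face X \<Longrightarrow> e = corner_edge (prv X)"
    by blast+
qed

lemma edge_ident_side:
  assumes "c \<in> crossings K" "mate K (c, X) = (c', X')" "card e = 2" "card e' = 2"
    "e \<subseteq> ccw_face X" "e' \<subseteq> cw_face X'" "vtype ` e = vtype ` e'"
  shows "((c, e), (c', e')) \<in> edge_ident K"
proof -
  have "((c, ccw_face X), (c', cw_face X')) \<in> face_pairing K"
    unfolding face_pairing_def glued_def using assms(1,2) by blast
  then show ?thesis
    unfolding edge_ident_def using assms(3-) by (intro UnI1 CollectI exI conjI) (rule refl | assumption)+
qed

context link_diagram
begin

lemma corner_edges_identified:
  assumes "c \<in> crossings K" "mate K (c, X) = (c', X')"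
  shows "((c, corner_edge X), (c', corner_edge (prv X'))) \<in> edge_ident K"
  by (rule edge_ident_side[OF assms])
    (cases X; cases X'; auto simp: corner_edge_def ccw_face_def cw_face_def over_def)+

lemma plus_edges_identified:
  assumes "c \<in> crossings K" "mate K (c, X) = (c', X')"
  shows "(c, plus_edge X) \<in> edge_class K z \<longleftrightarrow> (c', plus_edge X') \<in> edge_class K z"
proof -
  have c': "c' \<in> crossings K" using mate(1)[of "(c, X)"] assms by auto
  \<comment> \<open>The edge met across the side is the representative \<open>plus_edge X'\<close> or the other edge of the same
    octahedron that is identified with it.\<close>
  define e where "e = (if over X' then {Eq (prv X'), F} else {Eq X', E})"
  have "((c, plus_edge X), (c', e)) \<in> edge_ident K"
    by (rule edge_ident_side[OF assms])
      (cases X; cases X'; auto simp: e_def plus_edge_def ccw_face_def cw_face_def over_def apex_def)+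
  moreover have "e = plus_edge X' \<or> ((c', e), (c', plus_edge X')) \<in> edge_ident K \<or>
      ((c', plus_edge X'), (c', e)) \<in> edge_ident K"
    using c' by (cases X') (auto simp: e_def plus_edge_def over_def edge_ident_def)
  ultimately show ?thesis using edge_class_step by metis
qed

lemma minus_edges_identified:
  assumes "c \<in> crossings K" "mate K (c, X) = (c', X')"
  shows "(c, minus_edge X) \<in> edge_class K z \<longleftrightarrow> (c', minus_edge X') \<in> edge_class K z"
proof -
  have c': "c' \<in> crossings K" using mate(1)[of "(c, X)"] assms by auto
  define e where "e = (if over X then {Eq X, F} else {Eq (nxt X), E})"
  have "((c, e), (c', minus_edge X')) \<in> edge_ident K"
    by (rule edge_ident_side[OF assms])
      (cases X; cases X'; auto simp: e_def minus_edge_def ccw_face_def cw_face_def over_def apex_def)+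
  moreover have "e = minus_edge X \<or> ((c, e), (c, minus_edge X)) \<in> edge_ident K \<or>
      ((c, minus_edge X), (c, e)) \<in> edge_ident K"
    using assms(1) by (cases X) (auto simp: e_def minus_edge_def over_def edge_ident_def)
  ultimately show ?thesis using edge_class_step by metis
qed

lemma prod_tetrahedra:
  "(\<Prod>(c, \<tau>, e)\<in>{(c, \<tau>, e). c \<in> crossings K \<and> e \<in> tet_edges \<tau> \<and> (c, e) \<in> Q}. shape K w c \<tau> e) =
   (\<Prod>c\<in>crossings K. \<Prod>e\<in>octahedron_edges. if (c, e) \<in> Q then shapes_around K w c e else 1)"
proof -
  let ?S = "crossings K \<times> (UNIV :: tet set) \<times> octahedron_edges"
  let ?g = "\<lambda>c \<tau> e. if e \<in> tet_edges \<tau> \<and> (c, e) \<in> Q then shape K w c \<tau> e else 1"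
  have fin: "finite (UNIV :: tet set)" "finite octahedron_edges"
    unfolding UNIV_tet octahedron_edges_def by auto
  have "{(c, \<tau>, e). c \<in> crossings K \<and> e \<in> tet_edges \<tau> \<and> (c, e) \<in> Q} =
     {x \<in> ?S. case x of (c, \<tau>, e) \<Rightarrow> e \<in> tet_edges \<tau> \<and> (c, e) \<in> Q}"
    using tet_edges_subset by auto
  moreover have "finite ?S" using fin finite_crossings by blast
  ultimately have "(\<Prod>(c, \<tau>, e)\<in>{(c, \<tau>, e). c \<in> crossings K \<and> e \<in> tet_edges \<tau> \<and> (c, e) \<in> Q}. shape K w c \<tau> e) =
     (\<Prod>x\<in>?S. if (case x of (c, \<tau>, e) \<Rightarrow> e \<in> tet_edges \<tau> \<and> (c, e) \<in> Q) then (case x of (c, \<tau>, e) \<Rightarrow> shape K w c \<tau> e) else 1)"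
    by (simp only: prod.inter_filter)
  also have "\<dots> = (\<Prod>(c, \<tau>, e)\<in>?S. ?g c \<tau> e)"
    by (intro prod.cong refl) (simp add: case_prod_unfold)
  also have "\<dots> = (\<Prod>c\<in>crossings K. \<Prod>\<tau>\<in>UNIV. \<Prod>e\<in>octahedron_edges. ?g c \<tau> e)"
    by (simp add: prod.cartesian_product)
  also have "\<dots> = (\<Prod>c\<in>crossings K. \<Prod>e\<in>octahedron_edges. \<Prod>\<tau>\<in>UNIV. ?g c \<tau> e)"
    by (intro prod.cong refl prod.swap)
  also have "\<dots> = (\<Prod>c\<in>crossings K. \<Prod>e\<in>octahedron_edges. if (c, e) \<in> Q then shapes_around K w c e else 1)"
    unfolding shapes_around_def by (intro prod.cong refl) auto
  finally show ?thesis .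
qed

lemma prod_ends: "(\<Prod>c\<in>crossings K. \<Prod>X\<in>UNIV. g (c, X)) = (\<Prod>d\<in>ends K. g d)"
  unfolding ends_def by (simp add: prod.cartesian_product)

text \<open>
  Membership of the apex edges in a class is invariant under crossing a side, while their
  contributions are inverted.  Therefore these contributions cancel in every class, and only the
  equatorial edges remain.
\<close>

lemma prod_around_class:
  assumes nd: "\<And>c. c \<in> crossings K \<Longrightarrow> nondegenerate K w c" and Q: "Q = edge_class K z"
  shows "(\<Prod>(c, \<tau>, e)\<in>{(c, \<tau>, e). c \<in> crossings K \<and> e \<in> tet_edges \<tau> \<and> (c, e) \<in> Q}. shape K w c \<tau> e) =
   (\<Prod>(c, X)\<in>ends K. if (c, corner_edge X) \<in> Q then corner_factor K w c X else 1)"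
proof -
  define v where "v = (\<lambda>c X. w (region K (c, X)))"
  have nz: "v c X \<noteq> 0" if "c \<in> crossings K" for c X
    using nd[OF that] unfolding nondegenerate_def v_def by blast
  have q: "(c, {Eq B, F}) \<in> Q \<longleftrightarrow> (c, {Eq D, F}) \<in> Q" "(c, {Eq A, E}) \<in> Q \<longleftrightarrow> (c, {Eq C, E}) \<in> Q"
    if "c \<in> crossings K" for c
    unfolding Q by (rule edge_class_step; use that in \<open>auto simp: edge_ident_def\<close>)+
  let ?cf = "\<lambda>c X. if (c, corner_edge X) \<in> Q then corner_factor K w c X else 1"
  let ?pl = "\<lambda>c X. if (c, plus_edge X) \<in> Q then v c X / v c (prv X) else 1"
  let ?mi = "\<lambda>c X. if (c, minus_edge X) \<in> Q then v c (prv X) / v c X else 1"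
  have side: "v c' X' = v c (prv X)" "v c' (prv X') = v c X" "c' \<in> crossings K"
    if "c \<in> crossings K" "mate K (c, X) = (c', X')" for c X c' X'
    using region_across_side[OF that] mate(1)[of "(c, X)"] that by (auto simp: v_def)
  have pl: "(\<Prod>d\<in>ends K. case d of (c, X) \<Rightarrow> ?pl c X) = 1"
  proof -
    let ?P = "\<lambda>(c, X). (c, plus_edge X) \<in> Q" and ?h = "\<lambda>(c, X). v c X / v c (prv X)"
    have "?P (mate K d) = ?P d" "?h d * ?h (mate K d) = 1" if "d \<in> ends K" for d
    proof -
      obtain c X c' X' where d: "d = (c, X)" "mate K d = (c', X')" by (metis surj_pair)
      then show "?P (mate K d) = ?P d" "?h d * ?h (mate K d) = 1"
        using plus_edges_identified[of c X c' X'] side[of c X c' X'] that nz by (auto simp: Q)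
    qed
    then have "(\<Prod>d\<in>ends K. if ?P d then ?h d else 1) = 1" by (rule prod_over_sides_cancels)
    then show ?thesis by (simp add: case_prod_unfold cong: if_cong)
  qed
  have mi: "(\<Prod>d\<in>ends K. case d of (c, X) \<Rightarrow> ?mi c X) = 1"
  proof -
    let ?P = "\<lambda>(c, X). (c, minus_edge X) \<in> Q" and ?h = "\<lambda>(c, X). v c (prv X) / v c X"
    have "?P (mate K d) = ?P d" "?h d * ?h (mate K d) = 1" if "d \<in> ends K" for d
    proof -
      obtain c X c' X' where d: "d = (c, X)" "mate K d = (c', X')" by (metis surj_pair)
      then show "?P (mate K d) = ?P d" "?h d * ?h (mate K d) = 1"
        using minus_edges_identified[of c X c' X'] side[of c X c' X'] that nz by (auto simp: Q)
    qed
    then have "(\<Prod>d\<in>ends K. if ?P d then ?h d else 1) = 1" by (rule prod_over_sides_cancels)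
    then show ?thesis by (simp add: case_prod_unfold cong: if_cong)
  qed
  have "(\<Prod>c\<in>crossings K. \<Prod>e\<in>octahedron_edges. if (c, e) \<in> Q then shapes_around K w c e else 1) =
     (\<Prod>c\<in>crossings K. (\<Prod>X\<in>UNIV. ?cf c X) * (\<Prod>X\<in>UNIV. ?pl c X) * (\<Prod>X\<in>UNIV. ?mi c X))"
    by (intro prod.cong refl crossing_product nd q) (auto simp: v_def)
  also have "\<dots> = (\<Prod>(c, X)\<in>ends K. ?cf c X) * (\<Prod>(c, X)\<in>ends K. ?pl c X) * (\<Prod>(c, X)\<in>ends K. ?mi c X)"
    by (simp only: prod.distrib prod_ends[symmetric] case_prod_conv)
  also have "\<dots> = (\<Prod>(c, X)\<in>ends K. ?cf c X)"
    unfolding pl mi by simp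
  finally show ?thesis unfolding prod_tetrahedra .
qed

text \<open>
  Gluing across a side identifies the equatorial edge of a corner with that of the next corner of the
  same region.  No other identification involves edges joining the types \<open>-\<infinity>\<close> and \<open>\<infinity>\<close>, so the classes
  of equatorial edges are the regions.
\<close>

lemma corner_edge_class:
  assumes "d \<in> ends K" "d = (c0, X0)" "c \<in> crossings K"
  shows "(c, corner_edge X) \<in> edge_class K (c0, corner_edge X0) \<longleftrightarrow> region K (c, X) = region K d"
proof
  assume "region K (c, X) = region K d"
  then obtain n where n: "(c, X) = (next_corner K ^^ n) d"
    using self_in_region[of "(c, X)"] unfolding region_def by auto
  have "d' \<in> ends K \<and> (fst d', corner_edge (snd d')) \<in> edge_class K (c0, corner_edge X0)"
    if "d' = (next_corner K ^^ n) d" for d' n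
    using that
  proof (induction n arbitrary: d')
    case 0
    then show ?case using assms edge_class_self by auto
  next
    case (Suc n)
    define y where "y = (next_corner K ^^ n) d"
    have y: "y \<in> ends K" "(fst y, corner_edge (snd y)) \<in> edge_class K (c0, corner_edge X0)"
      using Suc.IH y_def by auto
    have d': "d' = mate K (fst y, nxt (snd y))"
      using Suc.prems y_def by (simp flip: next_corner_def)
    have e: "(fst y, nxt (snd y)) \<in> ends K" using y(1) by (cases y) auto
    have "mate K d' = (fst y, nxt (snd y))" "d' \<in> ends K"
      using mate[OF e] d' by auto
    moreover from this have "((fst d', corner_edge (snd d')), (fst y, corner_edge (snd y))) \<in> edge_ident K"
      using corner_edges_identified[of "fst d'" "snd d'" "fst y" "nxt (snd y)"] by (cases d') auto
    ultimately show ?case using y(2) edge_class_step by metis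
  qed
  from this[OF n] show "(c, corner_edge X) \<in> edge_class K (c0, corner_edge X0)" by simp
next
  \<comment> \<open>Being an equatorial edge of the region of \<open>d\<close> is invariant under every identification.\<close>
  define inv where "inv = (\<lambda>x. \<exists>X. fst x \<in> crossings K \<and> snd x = corner_edge X \<and> region K (fst x, X) = region K d)"
  have inv_corner: "inv (c, corner_edge X) \<longleftrightarrow> c \<in> crossings K \<and> region K (c, X) = region K d" for c X
    by (auto simp: inv_def)
  have glue: "inv (c, e) \<longleftrightarrow> inv (c', e')"
    if m: "c \<in> crossings K" "mate K (c, X) = (c', X')" and e: "e \<subseteq> ccw_face X" "e' \<subseteq> cw_face X'"
      "card e = 2" "card e' = 2" "vtype ` e = vtype ` e'" for c X c' X' e e'
  proof (cases "vtype ` e = {Minus_Infinity, Plus_Infinity}")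
    case True
    have "c' \<in> crossings K" using mate(1)[of "(c, X)"] m by auto
    then show ?thesis
      using corner_edge_of_face(1)[OF e(3) True e(1)] corner_edge_of_face(2)[OF e(4) _ e(2)] True e(5)
        region_across_side(1)[OF m] m(1) by (simp add: inv_corner)
  next
    case False
    then show ?thesis using vtype_corner_edge e(5) unfolding inv_def by (metis snd_conv)
  qed
  have step: "inv x \<longleftrightarrow> inv y" if "(x, y) \<in> edge_ident K" for x y
  proof -
    have no: "\<not> inv (c, {Eq X, E})" "\<not> inv (c, {Eq X, F})" for c X
      unfolding inv_def corner_edge_def by auto
    from that show ?thesis
      unfolding edge_ident_def face_pairing_def glued_def using glue by (auto simp: no)
  qed
  have "inv x \<longleftrightarrow> inv y" if "(x, y) \<in> (edge_ident K \<union> (edge_ident K)\<inverse>)\<^sup>*" for x y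
    using that by (induction rule: rtrancl_induct) (auto dest: step)
  moreover assume "(c, corner_edge X) \<in> edge_class K (c0, corner_edge X0)"
  moreover have "inv (c0, corner_edge X0)" using assms by (auto simp: inv_corner)
  ultimately have "inv (c, corner_edge X)" unfolding edge_class_def by blast
  then show "region K (c, X) = region K d" by (simp add: inv_corner)
qed

text \<open>
  A class without equatorial edges gives an equation that holds identically; a class with one gives the
  equation of its region.
\<close>

lemma gluing_equations_iff:
  assumes nd: "\<And>c. c \<in> crossings K \<Longrightarrow> nondegenerate K w c"
  shows "gluing_equations K w \<longleftrightarrow>
    (\<forall>R\<in>regions K. (\<Prod>(c, X)\<in>ends K. if region K (c, X) = R then corner_factor K w c X else 1) = 1)"
    (is "_ \<longleftrightarrow> (\<forall>R\<in>_. ?P R = 1)")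
proof -
  let ?prod = "\<lambda>Q. \<Prod>(c, \<tau>, e)\<in>{(c, \<tau>, e). c \<in> crossings K \<and> e \<in> tet_edges \<tau> \<and> (c, e) \<in> Q}. shape K w c \<tau> e"
  have corner: "?prod (edge_class K (c0, corner_edge X0)) = ?P (region K (c0, X0))" if "c0 \<in> crossings K" for c0 X0
  proof -
    have "?prod (edge_class K (c0, corner_edge X0)) = (\<Prod>(c, X)\<in>ends K.
        if (c, corner_edge X) \<in> edge_class K (c0, corner_edge X0) then corner_factor K w c X else 1)"
      using nd by (rule prod_around_class) auto
    also have "\<dots> = ?P (region K (c0, X0))"
      using that corner_edge_class[of "(c0, X0)" c0 X0] by (intro prod.cong refl) auto
    finally show ?thesis .
  qed
  show ?thesis
  proof
    assume g: "gluing_equations K w"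
    show "\<forall>R\<in>regions K. ?P R = 1"
    proof
      fix R assume "R \<in> regions K"
      then obtain c X where c: "c \<in> crossings K" "R = region K (c, X)"
        unfolding regions_def by auto
      have "corner_edge X \<in> tet_edges ABCD"
        by (cases X) (simp_all add: tet_edges_eq corner_edge_def insert_commute)
      then have "edge_class K (c, corner_edge X) \<in> triangulation_edges K"
        unfolding triangulation_edges_def using c(1) by blast
      then show "?P R = 1"
        using g corner[OF c(1), of X] c(2) unfolding gluing_equations_def by simp
    qed
  next
    assume P: "\<forall>R\<in>regions K. ?P R = 1"
    show "gluing_equations K w"
      unfolding gluing_equations_def
    proof
      fix Q assume "Q \<in> triangulation_edges K"
      then obtain z where Q: "Q = edge_class K z" unfolding triangulation_edges_def by auto
      show "?prod Q = 1"
      proof (cases "\<exists>c X. c \<in> crossings K \<and> (c, corner_edge X) \<in> Q")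
        case True
        then obtain c X where c: "c \<in> crossings K" "(c, corner_edge X) \<in> Q" by blast
        then have "Q = edge_class K (c, corner_edge X)" using edge_class_sym_trans Q by metis
        moreover have "region K (c, X) \<in> regions K" using c(1) unfolding regions_def by auto
        ultimately show ?thesis using corner[OF c(1), of X] P by simp
      next
        case False
        have "?prod Q = (\<Prod>(c, X)\<in>ends K. if (c, corner_edge X) \<in> Q then corner_factor K w c X else 1)"
          using nd Q by (rule prod_around_class)
        also have "\<dots> = 1" using False by (intro prod.neutral) auto
        finally show ?thesis .
      qed
    qed
  qed
qed

end

section \<open>Logarithmic derivatives of the potential function\<close>

text \<open>
  The operator \<open>z d/dz\<close> in relational form, which includes differentiability.
\<close>

definition euler_derivative :: "(complex \<Rightarrow> complex) \<Rightarrow> complex \<Rightarrow> complex \<Rightarrow> bool" where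
  "euler_derivative f z \<theta> \<longleftrightarrow> (\<exists>D. (f has_field_derivative D) (at z) \<and> \<theta> = z * D)"

text \<open>
  Homogeneity of degree \<open>\<nu>\<close> to first order at \<open>z\<close>.  The variable of a corner has weight 1 if it is the
  variable being differentiated and weight 0 otherwise, so a region meeting a crossing in two opposite
  corners needs no separate treatment.
\<close>

definition weight :: "(complex \<Rightarrow> complex) \<Rightarrow> complex \<Rightarrow> complex \<Rightarrow> bool" where
  "weight f z \<nu> \<longleftrightarrow> euler_derivative f z (\<nu> * f z)"

lemma euler_add: "euler_derivative f z \<theta> \<Longrightarrow> euler_derivative g z \<eta> \<Longrightarrow> euler_derivative (\<lambda>x. f x + g x) z (\<theta> + \<eta>)"
  unfolding euler_derivative_def by (metis DERIV_add distrib_left)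

lemma euler_diff: "euler_derivative f z \<theta> \<Longrightarrow> euler_derivative g z \<eta> \<Longrightarrow> euler_derivative (\<lambda>x. f x - g x) z (\<theta> - \<eta>)"
  unfolding euler_derivative_def by (metis DERIV_diff right_diff_distrib)

lemma euler_minus: "euler_derivative f z \<theta> \<Longrightarrow> euler_derivative (\<lambda>x. - f x) z (- \<theta>)"
  unfolding euler_derivative_def by (metis DERIV_minus mult_minus_right)

lemma euler_const: "euler_derivative (\<lambda>x. a) z 0"
  unfolding euler_derivative_def by (auto intro!: exI[of _ 0])

lemma euler_mult:
  assumes "euler_derivative f z \<theta>" "euler_derivative g z \<eta>"
  shows "euler_derivative (\<lambda>x. f x * g x) z (\<theta> * g z + f z * \<eta>)"
proof -
  obtain f' g' where "(f has_field_derivative f') (at z)" "(g has_field_derivative g') (at z)" "\<theta> = z * f'" "\<eta> = z * g'"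
    using assms unfolding euler_derivative_def by blast
  moreover from this have "((\<lambda>x. f x * g x) has_field_derivative f' * g z + g' * f z) (at z)"
    by (intro DERIV_mult)
  ultimately show ?thesis
    unfolding euler_derivative_def by (intro exI[of _ "f' * g z + g' * f z"]) (simp add: algebra_simps)
qed

lemma euler_sum:
  "(\<And>i. i \<in> I \<Longrightarrow> euler_derivative (f i) z (\<theta> i)) \<Longrightarrow> euler_derivative (\<lambda>x. \<Sum>i\<in>I. f i x) z (\<Sum>i\<in>I. \<theta> i)"
  by (induction I rule: infinite_finite_induct) (auto intro: euler_add euler_const)

lemma euler_compose:
  assumes "(f has_field_derivative c) (at (g z))" "weight g z \<nu>"
  shows "euler_derivative (\<lambda>x. f (g x)) z (c * g z * \<nu>)"
proof -
  obtain g' where "(g has_field_derivative g') (at z)" "\<nu> * g z = z * g'"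
    using assms(2) unfolding weight_def euler_derivative_def by blast
  moreover from assms(1) this(1) have "((\<lambda>x. f (g x)) has_field_derivative c * g') (at z)"
    by (rule DERIV_chain2)
  ultimately show ?thesis
    unfolding euler_derivative_def by (intro exI[of _ "c * g'"]) (simp add: algebra_simps)
qed

lemma weight_mult: "weight f z \<nu> \<Longrightarrow> weight g z \<mu> \<Longrightarrow> weight (\<lambda>x. f x * g x) z (\<nu> + \<mu>)"
  unfolding weight_def by (drule (1) euler_mult) (simp add: algebra_simps)

lemma weight_divide:
  assumes "weight f z \<nu>" "weight g z \<mu>" "g z \<noteq> 0"
  shows "weight (\<lambda>x. f x / g x) z (\<nu> - \<mu>)"
proof -
  obtain f' g' where D: "(f has_field_derivative f') (at z)" "(g has_field_derivative g') (at z)"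
      "\<nu> * f z = z * f'" "\<mu> * g z = z * g'"
    using assms unfolding weight_def euler_derivative_def by blast
  have "(\<nu> - \<mu>) * (f z / g z) = ((\<nu> * f z) * g z - f z * (\<mu> * g z)) / (g z * g z)"
    using assms(3) by (simp add: field_simps)
  also have "\<dots> = z * ((f' * g z - f z * g') / (g z * g z))"
    unfolding D(3,4) by (simp add: algebra_simps)
  finally show ?thesis
    unfolding weight_def euler_derivative_def using DERIV_divide[OF D(1,2) assms(3)] by blast
qed

lemma weight_coordinate: "weight (\<lambda>x. (w(R := x)) S) (w R) (of_bool (S = R))"
proof (cases "S = R")
  case True
  then show ?thesis unfolding weight_def euler_derivative_def by (intro exI[of _ 1]) simp
next
  case False
  then show ?thesis unfolding weight_def euler_derivative_def by (intro exI[of _ 0]) simp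
qed

lemma exp_of_bool_mult: "exp (of_bool P * x) = (if P then exp x else (1 :: complex))"
  by simp

text \<open>
  Applying \<open>z d/dz\<close> to a dilogarithm of an argument \<open>a\<close> gives \<open>- log (1 - a)\<close> times the weight of \<open>a\<close>.
  After exponentiation the choice of the logarithms is irrelevant, and what remains is one rational
  factor for each corner that lies in the region.
\<close>

lemma potential_P_euler:
  assumes li: "\<And>i. i < 5 \<Longrightarrow> dilog_branch (dilog_args j k l m ! i) (li i)"
    and lg: "log_branch (m / j) (lg 0)" "log_branch (k / j) (lg 1)"
    and nz: "j \<noteq> 0" "k \<noteq> 0" "l \<noteq> 0" "m \<noteq> 0"
    and v: "fj z = j" "fk z = k" "fl z = l" "fm z = m"
    and wt: "weight fj z (of_bool pj)" "weight fk z (of_bool pk)" "weight fl z (of_bool pl)" "weight fm z (of_bool pm)"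
  obtains \<theta> where "euler_derivative (\<lambda>x. potential_P li lg (fj x) (fk x) (fl x) (fm x)) z \<theta>"
    "exp \<theta> = (if pj then quad_factor j k l m else 1) * (if pk then 1 / quad_factor k l m j else 1) *
       (if pl then quad_factor l m j k else 1) * (if pm then 1 / quad_factor m j k l else 1)"
proof -
  have br: "dilog_branch (l / m) (li 0)" "dilog_branch (l / k) (li 1)" "dilog_branch ((j * l) / (k * m)) (li 2)"
    "dilog_branch (m / j) (li 3)" "dilog_branch (k / j) (li 4)"
    using li[of 0] li[of 1] li[of 2] li[of 3] li[of 4] by (simp_all add: dilog_args_def)
  obtain L0 where L0: "exp L0 = 1 - l / m" "(li 0 has_field_derivative - L0 / (l / m)) (at (l / m))"
    using dilog_branch_derivative[OF br(1)] .
  obtain L1 where L1: "exp L1 = 1 - l / k" "(li 1 has_field_derivative - L1 / (l / k)) (at (l / k))"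
    using dilog_branch_derivative[OF br(2)] .
  obtain L2 where L2: "exp L2 = 1 - (j * l) / (k * m)"
      "(li 2 has_field_derivative - L2 / ((j * l) / (k * m))) (at ((j * l) / (k * m)))"
    using dilog_branch_derivative[OF br(3)] .
  obtain L3 where L3: "exp L3 = 1 - m / j" "(li 3 has_field_derivative - L3 / (m / j)) (at (m / j))"
    using dilog_branch_derivative[OF br(4)] .
  obtain L4 where L4: "exp L4 = 1 - k / j" "(li 4 has_field_derivative - L4 / (k / j)) (at (k / j))"
    using dilog_branch_derivative[OF br(5)] .
  define G0 G1 where "G0 = lg 0 (m / j)" "G1 = lg 1 (k / j)"
  have G: "exp G0 = m / j" "exp G1 = k / j"
    using log_branch_derivative(1)[OF lg(1)] log_branch_derivative(1)[OF lg(2)] by (simp_all add: G0_G1_def)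
  let ?j = "of_bool pj :: complex" and ?k = "of_bool pk :: complex"
    and ?l = "of_bool pl :: complex" and ?m = "of_bool pm :: complex"
  have w0: "weight (\<lambda>x. fl x / fm x) z (?l - ?m)" "weight (\<lambda>x. fl x / fk x) z (?l - ?k)"
    "weight (\<lambda>x. (fj x * fl x) / (fk x * fm x)) z ((?j + ?l) - (?k + ?m))"
    "weight (\<lambda>x. fm x / fj x) z (?m - ?j)" "weight (\<lambda>x. fk x / fj x) z (?k - ?j)"
    using nz v by (intro weight_divide weight_mult wt; simp)+
  have dl: "euler_derivative (\<lambda>x. f (g x)) z (- L * \<nu>)"
    if "weight g z \<nu>" "(f has_field_derivative - L / a) (at a)" "g z = a" "a \<noteq> 0" for f g L \<nu> a
    using euler_compose[of f "- L / a" g z \<nu>] that by simp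
  have lgd: "euler_derivative (\<lambda>x. f (g x)) z \<nu>"
    if "weight g z \<nu>" "log_branch a f" "g z = a" "a \<noteq> 0" for f g \<nu> a
    using euler_compose[of f "1 / a" g z \<nu>] log_branch_derivative(2)[OF that(2)] that by simp
  define \<theta> where "\<theta> = - (- L0 * (?l - ?m)) - (- L1 * (?l - ?k)) + (- L2 * ((?j + ?l) - (?k + ?m)))
     + (- L3 * (?m - ?j)) + (- L4 * (?k - ?j)) - 0 + ((?m - ?j) * G1 + G0 * (?k - ?j))"
  have "euler_derivative (\<lambda>x. potential_P li lg (fj x) (fk x) (fl x) (fm x)) z \<theta>"
  proof -
    have "euler_derivative (\<lambda>x. lg 0 (fm x / fj x) * lg 1 (fk x / fj x)) z
        ((?m - ?j) * lg 1 (fk z / fj z) + lg 0 (fm z / fj z) * (?k - ?j))"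
      using nz v by (intro euler_mult lgd[OF w0(4) lg(1)] lgd[OF w0(5) lg(2)]) auto
    then have "euler_derivative (\<lambda>x. lg 0 (fm x / fj x) * lg 1 (fk x / fj x)) z ((?m - ?j) * G1 + G0 * (?k - ?j))"
      by (simp add: G0_G1_def v)
    then show ?thesis
      unfolding potential_P_def \<theta>_def using nz v
      by (intro euler_add euler_diff euler_minus euler_const dl[OF w0(1) L0(2)] dl[OF w0(2) L1(2)]
          dl[OF w0(3) L2(2)] dl[OF w0(4) L3(2)] dl[OF w0(5) L4(2)]) auto
  qed
  moreover have "exp \<theta> = (if pj then quad_factor j k l m else 1) * (if pk then 1 / quad_factor k l m j else 1) *
       (if pl then quad_factor l m j k else 1) * (if pm then 1 / quad_factor m j k l else 1)"
  proof -
    have "\<theta> = ?j * (L3 + L4 - L2 - G1 - G0) + ?k * (L2 - L1 - L4 + G0) + ?l * (L0 + L1 - L2) + ?m * (L2 - L0 - L3 + G1)"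
      unfolding \<theta>_def by (simp add: algebra_simps)
    then have "exp \<theta> = (if pj then exp (L3 + L4 - L2 - G1 - G0) else 1) * (if pk then exp (L2 - L1 - L4 + G0) else 1) *
       (if pl then exp (L0 + L1 - L2) else 1) * (if pm then exp (L2 - L0 - L3 + G1) else 1)"
      by (simp only: exp_add exp_of_bool_mult)
    moreover have ne: "l \<noteq> m" "l \<noteq> k" "j * l \<noteq> k * m" "m \<noteq> j" "k \<noteq> j"
    proof -
      have "exp L0 \<noteq> 0" "exp L1 \<noteq> 0" "exp L2 \<noteq> 0" "exp L3 \<noteq> 0" "exp L4 \<noteq> 0" by simp_all
      then show "l \<noteq> m" "l \<noteq> k" "j * l \<noteq> k * m" "m \<noteq> j" "k \<noteq> j"
        unfolding L0 L1 L2 L3 L4 using nz by auto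
    qed
    note ex = exp_add exp_diff L0(1) L1(1) L2(1) L3(1) L4(1) G
    have "exp (L3 + L4 - L2 - G1 - G0) = quad_factor j k l m"
      unfolding ex quad_factor_def using nz ne by (simp add: divide_simps) algebra
    moreover have "exp (L2 - L1 - L4 + G0) = 1 / quad_factor k l m j"
      unfolding ex quad_factor_def using nz ne by (simp add: divide_simps) algebra
    moreover have "exp (L0 + L1 - L2) = quad_factor l m j k"
      unfolding ex quad_factor_def by (simp add: mult.commute)
    moreover have "exp (L2 - L0 - L3 + G1) = 1 / quad_factor m j k l"
      unfolding ex quad_factor_def using nz ne by (simp add: divide_simps) algebra
    ultimately show ?thesis by simp
  qed
  ultimately show thesis using that by blast
qed

lemma admissible_nondegenerate:
  assumes "admissible K w" "c \<in> crossings K"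
  shows "nondegenerate K w c"
proof -
  define j k l m where jklm: "j = wj K w c" "k = wk K w c" "l = wl K w c" "m = wm K w c"
  have "\<forall>x\<in>set (dilog_args j k l m). x \<noteq> 0 \<and> x \<noteq> 1"
    using assms unfolding admissible_def jklm by blast
  then have "j \<noteq> 0" "k \<noteq> 0" "l \<noteq> 0" "m \<noteq> 0" "l \<noteq> m" "l \<noteq> k" "j * l \<noteq> k * m" "m \<noteq> j" "k \<noteq> j"
    by (simp_all add: dilog_args_def, auto)
  note * = this[unfolded jklm wj_def wk_def wl_def wm_def]
  have "w (region K (c, X)) \<noteq> 0 \<and> w (region K (c, X)) \<noteq> w (region K (c, nxt X))" for X
    using * *(5,6,8,9)[symmetric] by (cases "bottom K c"; cases X; simp)
  moreover have "w (region K (c, A)) * w (region K (c, C)) \<noteq> w (region K (c, B)) * w (region K (c, D))"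
    using *(7) *(7)[symmetric] by (cases "bottom K c"; simp add: mult.commute)
  ultimately show ?thesis unfolding nondegenerate_def by blast
qed

text \<open>
  A crossing whose lower left end lies on the under-strand has the opposite sign in \<open>W\<close>, which
  compensates the inversion of \<open>corner_factor\<close> under a quarter turn.  So the same formula holds for
  both signs.
\<close>

lemma crossing_potential:
  fixes w :: "'c region_vars" and li lg :: "nat \<Rightarrow> complex \<Rightarrow> complex"
  assumes nd: "nondegenerate K w c"
    and li: "\<And>i. i < 5 \<Longrightarrow> dilog_branch (dilog_args (wj K w c) (wk K w c) (wl K w c) (wm K w c) ! i) (li i)"
    and lg: "log_branch (wm K w c / wj K w c) (lg 0)" "log_branch (wk K w c / wj K w c) (lg 1)"
  obtains \<theta> where
    "euler_derivative (\<lambda>x. (if positive K c then 1 else - 1) *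
       potential_P li lg (wj K (w(R := x)) c) (wk K (w(R := x)) c) (wl K (w(R := x)) c) (wm K (w(R := x)) c)) (w R) \<theta>"
    "exp \<theta> = (\<Prod>X\<in>UNIV. if region K (c, X) = R then corner_factor K w c X else 1)"
proof -
  define X0 where "X0 = bottom K c"
  let ?in = "\<lambda>X. region K (c, X) = R"
  have nz: "wj K w c \<noteq> 0" "wk K w c \<noteq> 0" "wl K w c \<noteq> 0" "wm K w c \<noteq> 0"
    using nd unfolding nondegenerate_def wj_def wk_def wl_def wm_def by blast+
  have triv: "w(R := w R) = w" by simp
  obtain \<theta> where \<theta>: "euler_derivative (\<lambda>x. potential_P li lg (wj K (w(R := x)) c) (wk K (w(R := x)) c)
        (wl K (w(R := x)) c) (wm K (w(R := x)) c)) (w R) \<theta>"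
    "exp \<theta> = (if ?in X0 then quad_factor (wj K w c) (wk K w c) (wl K w c) (wm K w c) else 1) *
       (if ?in (nxt X0) then 1 / quad_factor (wk K w c) (wl K w c) (wm K w c) (wj K w c) else 1) *
       (if ?in (nxt (nxt X0)) then quad_factor (wl K w c) (wm K w c) (wj K w c) (wk K w c) else 1) *
       (if ?in (nxt (nxt (nxt X0))) then 1 / quad_factor (wm K w c) (wj K w c) (wk K w c) (wl K w c) else 1)"
  proof (rule potential_P_euler[OF li lg nz])
    show "weight (\<lambda>x. wj K (w(R := x)) c) (w R) (of_bool (?in X0))"
      "weight (\<lambda>x. wk K (w(R := x)) c) (w R) (of_bool (?in (nxt X0)))"
      "weight (\<lambda>x. wl K (w(R := x)) c) (w R) (of_bool (?in (nxt (nxt X0))))"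
      "weight (\<lambda>x. wm K (w(R := x)) c) (w R) (of_bool (?in (nxt (nxt (nxt X0)))))"
      unfolding wj_def wk_def wl_def wm_def X0_def by (rule weight_coordinate)+
  qed (simp_all only: triv)
  define \<theta>' where "\<theta>' = (if positive K c then 1 else - 1) * \<theta>"
  have "euler_derivative (\<lambda>x. (if positive K c then 1 else - 1) *
       potential_P li lg (wj K (w(R := x)) c) (wk K (w(R := x)) c) (wl K (w(R := x)) c) (wm K (w(R := x)) c)) (w R) \<theta>'"
    using \<theta>(1) euler_minus[OF \<theta>(1)] by (simp add: \<theta>'_def)
  moreover have "exp \<theta>' = (\<Prod>X\<in>UNIV. if ?in X then corner_factor K w c X else 1)"
  proof -
    have e: "exp \<theta>' = (if over X0 then exp \<theta> else 1 / exp \<theta>)"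
      by (simp add: \<theta>'_def positive_def X0_def exp_minus inverse_eq_divide)
    \<comment> \<open>The variables are numbered from the bottom corner, wherever it lies relative to the over-strand.\<close>
    have rot: "(\<Prod>X\<in>UNIV. g X) = g X0 * g (nxt X0) * g (nxt (nxt X0)) * g (nxt (nxt (nxt X0)))"
      for g :: "end_pos \<Rightarrow> complex"
      unfolding prod_end_pos by (cases X0) (simp_all add: mult_ac)
    have per: "nxt (nxt (nxt (nxt X))) = X" "prv X = nxt (nxt (nxt X))" for X
      by (cases X; simp)+
    show ?thesis
      unfolding rot e \<theta>(2) corner_factor_def Let_def per over_nxt_prv wj_def wk_def wl_def wm_def X0_def[symmetric]
      by (cases "over X0"; cases "?in X0"; cases "?in (nxt X0)"; cases "?in (nxt (nxt X0))";
          cases "?in (nxt (nxt (nxt X0)))"; simp)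
  qed
  ultimately show thesis using that by blast
qed

context link_diagram
begin

lemma potential_equations_iff:
  assumes nd: "\<And>c. c \<in> crossings K \<Longrightarrow> nondegenerate K w c" and W: "potential_function K w W"
  shows "potential_equations K W w \<longleftrightarrow>
    (\<forall>R\<in>regions K. (\<Prod>(c, X)\<in>ends K. if region K (c, X) = R then corner_factor K w c X else 1) = 1)"
proof -
  obtain li lg where br: "\<forall>c\<in>crossings K.
        (\<forall>i<5. dilog_branch (dilog_args (wj K w c) (wk K w c) (wl K w c) (wm K w c) ! i) (li c i)) \<and>
        log_branch (wm K w c / wj K w c) (lg c 0) \<and> log_branch (wk K w c / wj K w c) (lg c 1)"
    and W': "W = (\<lambda>v. \<Sum>c\<in>crossings K. (if positive K c then 1 else - 1) *
               potential_P (li c) (lg c) (wj K v c) (wk K v c) (wl K v c) (wm K v c))"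
    using W unfolding potential_function_def by (elim exE conjE) (erule that, assumption)
  have "exp (w R * deriv (\<lambda>z. W (w(R := z))) (w R)) =
      (\<Prod>(c, X)\<in>ends K. if region K (c, X) = R then corner_factor K w c X else 1)" for R
  proof -
    define summand where "summand = (\<lambda>c x. (if positive K c then 1 else - 1) * potential_P (li c) (lg c)
         (wj K (w(R := x)) c) (wk K (w(R := x)) c) (wl K (w(R := x)) c) (wm K (w(R := x)) c))"
    have "\<exists>\<theta>. euler_derivative (summand c) (w R) \<theta> \<and>
       exp \<theta> = (\<Prod>X\<in>UNIV. if region K (c, X) = R then corner_factor K w c X else 1)" if c: "c \<in> crossings K" for c
      unfolding summand_def
    proof (rule crossing_potential[where R = R and li = "li c" and lg = "lg c", OF nd[OF c]])
      show "dilog_branch (dilog_args (wj K w c) (wk K w c) (wl K w c) (wm K w c) ! i) (li c i)" if "i < 5" for i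
        using br c that by blast
      show "log_branch (wm K w c / wj K w c) (lg c 0)" "log_branch (wk K w c / wj K w c) (lg c 1)"
        using br c by blast+
    qed blast
    then obtain \<theta> where \<theta>: "\<And>c. c \<in> crossings K \<Longrightarrow> euler_derivative (summand c) (w R) (\<theta> c)"
       "\<And>c. c \<in> crossings K \<Longrightarrow> exp (\<theta> c) = (\<Prod>X\<in>UNIV. if region K (c, X) = R then corner_factor K w c X else 1)"
      by metis
    have "euler_derivative (\<lambda>x. W (w(R := x))) (w R) (\<Sum>c\<in>crossings K. \<theta> c)"
      using euler_sum[OF \<theta>(1)] unfolding W' summand_def .
    then obtain dW where "((\<lambda>x. W (w(R := x))) has_field_derivative dW) (at (w R))"
        "(\<Sum>c\<in>crossings K. \<theta> c) = w R * dW"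
      unfolding euler_derivative_def by blast
    then have "exp (w R * deriv (\<lambda>z. W (w(R := z))) (w R)) = exp (\<Sum>c\<in>crossings K. \<theta> c)"
      by (simp add: DERIV_imp_deriv)
    also have "\<dots> = (\<Prod>c\<in>crossings K. \<Prod>X\<in>UNIV. if region K (c, X) = R then corner_factor K w c X else 1)"
      unfolding exp_sum[OF finite_crossings] by (intro prod.cong refl \<theta>(2))
    also have "\<dots> = (\<Prod>(c, X)\<in>ends K. if region K (c, X) = R then corner_factor K w c X else 1)"
      using prod_ends[of "\<lambda>(c, X). if region K (c, X) = R then corner_factor K w c X else 1"] by simp
    finally show ?thesis .
  qed
  then show ?thesis unfolding potential_equations_def by simp
qed

end

section \<open>Holonomy of the cusps\<close>

lemma develops_append:
  assumes "develops K w s ts s' h" "develops K w s' ts' s'' h'"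
  shows "develops K w s (ts @ ts') s'' (h * h')"
  using assms
proof (induction rule: develops.induct)
  case (stop s)
  then show ?case by simp
next
  case (left x a b y c \<tau> s' ts s0 h)
  then show ?case using develops.left[OF left(1-3), of w "ts @ ts'" s'' "h * h'"] by (simp add: mult.assoc)
next
  case (right x a b y c \<tau> s' ts s0 h)
  then show ?case using develops.right[OF right(1-3), of w "ts @ ts'" s'' "h * h'"] by simp
qed

lemma develops_left:
  assumes "distinct [x, a, b, y]" "verts \<tau> = {x, a, b, y}" "adjacent K (c, \<tau>, x, a, y) s'"
  shows "develops K w (c, \<tau>, x, a, b) [Left_Turn] s' (shape K w c \<tau> {x, a})"
  using develops.left[OF assms develops.stop] by simp

lemma develops_right:
  assumes "distinct [x, a, b, y]" "verts \<tau> = {x, a, b, y}" "adjacent K (c, \<tau>, x, y, b) s'"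
  shows "develops K w (c, \<tau>, x, a, b) [Right_Turn] s' (1 / shape K w c \<tau> {x, b})"
  using develops.right[OF assms develops.stop] by simp

text \<open>
  The flag by which a curve on the left of a strand enters the octahedron at an end, through the face
  \<open>cw_face X\<close>, and the flag by which such a curve leaves it at an end, through \<open>ccw_face X\<close>, recorded in
  the tetrahedron containing that face.
\<close>

fun entry_flag :: "'c \<times> end_pos \<Rightarrow> 'c flag" where
  "entry_flag (c, A) = (c, ABDF, F, Eq D, Eq A)"
| "entry_flag (c, B) = (c, ABCE, E, Eq B, Eq A)"
| "entry_flag (c, C) = (c, BCDF, F, Eq B, Eq C)"
| "entry_flag (c, D) = (c, ACDE, E, Eq D, Eq C)"

fun exit_flag :: "'c \<times> end_pos \<Rightarrow> 'c flag" where
  "exit_flag (c, A) = (c, ABDF, F, Eq B, Eq A)"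
| "exit_flag (c, B) = (c, ABCE, E, Eq B, Eq C)"
| "exit_flag (c, C) = (c, BCDF, F, Eq D, Eq C)"
| "exit_flag (c, D) = (c, ACDE, E, Eq D, Eq A)"

text \<open>
  The quantity that telescopes along the longitude.
\<close>

definition entry_ratio :: "'c diagram \<Rightarrow> 'c region_vars \<Rightarrow> 'c \<times> end_pos \<Rightarrow> complex" where
  "entry_ratio K w d = 1 - w (region K d) / w (region K (fst d, prv (snd d)))"

context link_diagram
begin

lemma adjacent_across_side:
  assumes "c \<in> crossings K"
  shows "adjacent K (exit_flag (c, X)) (entry_flag (mate K (c, X)))"
proof -
  obtain c' X' where m: "mate K (c, X) = (c', X')" by (metis surj_pair)
  have "((c, ccw_face X), (c', cw_face X')) \<in> face_pairing K"
    unfolding face_pairing_def glued_def using assms m by blast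
  then show ?thesis
    unfolding m by (cases X; cases X'; simp add: verts_def ccw_face_def cw_face_def apex_def over_def insert_commute)
qed

text \<open>
  A turn about the end \<open>X\<close> from the face on one side of the strand to the face on the other side,
  followed by the passage through the latter, contributes the ratio of the two adjacent regions.  Two
  such turns, one at each end of a side, make a meridian, and their ratios are inverse to each other.
\<close>

lemma side_turn:
  assumes "c \<in> crossings K"
  shows "over X \<Longrightarrow> develops K w (entry_flag (c, X)) [Right_Turn] (entry_flag (mate K (c, X)))
           (1 / (w (region K (c, prv X)) / w (region K (c, X))))"
    "\<not> over X \<Longrightarrow> develops K w (entry_flag (c, X)) [Left_Turn] (entry_flag (mate K (c, X)))
           (w (region K (c, X)) / w (region K (c, prv X)))"
proof -
  note adj = adjacent_across_side[OF assms]
  have "develops K w (entry_flag (c, A)) [Right_Turn] (entry_flag (mate K (c, A))) (1 / shape K w c ABDF {F, Eq A})"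
    unfolding entry_flag.simps by (rule develops_right[where y = "Eq B"]) (use adj[of A] in \<open>auto simp: verts_def\<close>)
  moreover have "develops K w (entry_flag (c, C)) [Right_Turn] (entry_flag (mate K (c, C))) (1 / shape K w c BCDF {F, Eq C})"
    unfolding entry_flag.simps by (rule develops_right[where y = "Eq D"]) (use adj[of C] in \<open>auto simp: verts_def\<close>)
  ultimately show "over X \<Longrightarrow> develops K w (entry_flag (c, X)) [Right_Turn] (entry_flag (mate K (c, X)))
           (1 / (w (region K (c, prv X)) / w (region K (c, X))))"
    by (cases X) (auto simp: shape_def doubleton_eq_iff over_def)
  have "develops K w (entry_flag (c, B)) [Left_Turn] (entry_flag (mate K (c, B))) (shape K w c ABCE {E, Eq B})"
    unfolding entry_flag.simps by (rule develops_left[where y = "Eq C"]) (use adj[of B] in \<open>auto simp: verts_def\<close>)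
  moreover have "develops K w (entry_flag (c, D)) [Left_Turn] (entry_flag (mate K (c, D))) (shape K w c ACDE {E, Eq D})"
    unfolding entry_flag.simps by (rule develops_left[where y = "Eq A"]) (use adj[of D] in \<open>auto simp: verts_def\<close>)
  ultimately show "\<not> over X \<Longrightarrow> develops K w (entry_flag (c, X)) [Left_Turn] (entry_flag (mate K (c, X)))
           (w (region K (c, X)) / w (region K (c, prv X)))"
    by (cases X) (auto simp: shape_def doubleton_eq_iff over_def)
qed

text \<open>
  A passage crosses two triangles.  The shape parameter of the first depends only on the regions
  adjacent to the end of entry, that of the second only on those adjacent to the end of exit, and these
  are the regions adjacent to the end of entry of the next passage.
\<close>

lemma passage_turns:
  assumes "d \<in> ends K"
  shows "develops K w (entry_flag d) (if over (snd d) then [Left_Turn, Left_Turn] else [Right_Turn, Right_Turn])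
     (entry_flag (next_passage K d)) (entry_ratio K w d / entry_ratio K w (next_passage K d))"
proof -
  obtain c X where d: "d = (c, X)" "c \<in> crossings K" using assms by (cases d) auto
  note adj = adjacent_across_side[OF d(2)]
  let ?v = "\<lambda>X. w (region K (c, X))"
  have ratio: "entry_ratio K w (mate K (c, Y)) = 1 - ?v (prv Y) / ?v Y" for Y
  proof -
    obtain c' X' where "mate K (c, Y) = (c', X')" by (metis surj_pair)
    then show ?thesis
      using region_across_side[OF d(2), of Y c' X'] by (simp add: entry_ratio_def)
  qed
  note two = develops_append[where ts = "[_]" and ts' = "[_]", simplified]
  have "develops K w (entry_flag (c, A)) [Left_Turn, Left_Turn] (entry_flag (mate K (c, C)))
      (shape K w c ABDF {F, Eq D} * shape K w c BCDF {F, Eq D})"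
    unfolding entry_flag.simps
    by (rule two, rule develops_left[where y = "Eq B" and s' = "(c, BCDF, F, Eq D, Eq B)"],
        auto simp: verts_def) (rule develops_left[where y = "Eq C"]; use adj[of C] in \<open>auto simp: verts_def\<close>)
  moreover have "develops K w (entry_flag (c, C)) [Left_Turn, Left_Turn] (entry_flag (mate K (c, A)))
      (shape K w c BCDF {F, Eq B} * shape K w c ABDF {F, Eq B})"
    unfolding entry_flag.simps
    by (rule two, rule develops_left[where y = "Eq D" and s' = "(c, ABDF, F, Eq B, Eq D)"],
        auto simp: verts_def) (rule develops_left[where y = "Eq A"]; use adj[of A] in \<open>auto simp: verts_def\<close>)
  moreover have "develops K w (entry_flag (c, B)) [Right_Turn, Right_Turn] (entry_flag (mate K (c, D)))
      (1 / shape K w c ABCE {E, Eq A} * (1 / shape K w c ACDE {E, Eq A}))"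
    unfolding entry_flag.simps
    by (rule two, rule develops_right[where y = "Eq C" and s' = "(c, ACDE, E, Eq C, Eq A)"],
        auto simp: verts_def) (rule develops_right[where y = "Eq D", simplified]; use adj[of D] in \<open>auto simp: verts_def\<close>)
  moreover have "develops K w (entry_flag (c, D)) [Right_Turn, Right_Turn] (entry_flag (mate K (c, B)))
      (1 / shape K w c ACDE {E, Eq C} * (1 / shape K w c ABCE {E, Eq C}))"
    unfolding entry_flag.simps
    by (rule two, rule develops_right[where y = "Eq A" and s' = "(c, ABCE, E, Eq A, Eq C)"],
        auto simp: verts_def) (rule develops_right[where y = "Eq B", simplified]; use adj[of B] in \<open>auto simp: verts_def\<close>)
  ultimately show ?thesis
    unfolding d(1)
    by (cases X) (simp_all add: next_passage_def ratio shape_def doubleton_eq_iff over_def, simp_all add: entry_ratio_def)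
qed

lemma next_passage_in_ends: "d \<in> ends K \<Longrightarrow> next_passage K d \<in> ends K"
  unfolding next_passage_def by (intro mate) (cases d; simp)

lemma passages_return:
  assumes "d \<in> ends K"
  shows "(next_passage K ^^ passages K d) d = d"
proof -
  have inj: "inj_on (next_passage K) (ends K)"
  proof (rule inj_onI)
    fix d d' assume d: "d \<in> ends K" "d' \<in> ends K" "next_passage K d = next_passage K d'"
    then have "(fst d, nxt (nxt (snd d))) = (fst d', nxt (nxt (snd d')))"
      unfolding next_passage_def by (metis in_ends mate(2) prod.collapse)
    then show "d = d'" by (metis nxt_prv(2) prod.collapse prod.inject)
  qed
  obtain n where "0 < n" "(next_passage K ^^ n) d = d"
    using funpow_returns[OF finite_ends next_passage_in_ends inj assms] by blast
  then have "0 < n \<and> (next_passage K ^^ n) d = d" by simp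
  then have "0 < passages K d \<and> (next_passage K ^^ passages K d) d = d"
    unfolding passages_def by (rule LeastI)
  then show ?thesis by blast
qed

lemma develops_passages:
  assumes "d \<in> ends K" "\<And>d. d \<in> ends K \<Longrightarrow> entry_ratio K w d \<noteq> 0"
  shows "develops K w (entry_flag d) (concat (map (\<lambda>i. if over (snd ((next_passage K ^^ i) d))
      then [Left_Turn, Left_Turn] else [Right_Turn, Right_Turn]) [0..<n]))
    (entry_flag ((next_passage K ^^ n) d)) (entry_ratio K w d / entry_ratio K w ((next_passage K ^^ n) d))"
proof (induction n)
  case 0
  then show ?case using assms develops.stop[of K w "entry_flag d"] by simp
next
  case (Suc n)
  have e: "(next_passage K ^^ m) d \<in> ends K" for m
    by (induction m) (auto simp: assms(1) next_passage_in_ends)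
  show ?case
    using develops_append[OF Suc passage_turns[OF e]] assms(2)[OF e] by simp
qed

text \<open>
  The meridian turns about both ends of a side with inverse contributions.  Along the longitude the
  ratios at the entries of the passages cancel from one passage to the next, and the curve closes up.
\<close>

lemma completeness_holds:
  assumes nd: "\<And>c. c \<in> crossings K \<Longrightarrow> nondegenerate K w c"
  shows "completeness K w"
  unfolding completeness_def
proof
  fix d assume "d \<in> cusp_bases K"
  then obtain c X c' X' where d: "d = (c, X)" "c \<in> crossings K" "\<not> over X"
      and m: "mate K d = (c', X')" "over X'"
    unfolding cusp_bases_def by (metis (no_types, lifting) in_ends mem_Collect_eq prod.collapse)
  have c': "c' \<in> crossings K" "mate K (c', X') = d"
    using mate[of d] d m by auto
  have nz: "w (region K (c, X)) \<noteq> 0" "w (region K (c, prv X)) \<noteq> 0"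
    and ne: "w (region K (c, prv X)) \<noteq> w (region K (c, X))" if "c \<in> crossings K" for c X
    using nd[OF that] unfolding nondegenerate_def by (auto, metis nxt_prv(1))
  have base: "base_flag d = entry_flag d"
    using d by (cases X) (auto simp: base_flag_def over_def)
  note side = region_across_side[OF d(2) m(1)[unfolded d(1)]]
  have "develops K w (entry_flag d) ([Left_Turn] @ [Right_Turn]) (entry_flag d)
      (w (region K (c, X)) / w (region K (c, prv X)) * (1 / (w (region K (c', prv X')) / w (region K (c', X')))))"
    by (rule develops_append) (use side_turn(2)[OF d(2,3), of w] side_turn(1)[OF c'(1) m(2), of w] d m c' in auto)
  then have "acts_as_translation K w (base_flag d) meridian"
    using nz[OF d(2)] by (simp add: base acts_as_translation_def meridian_def side)
  moreover have "entry_ratio K w d \<noteq> 0" if "d \<in> ends K" for d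
    using that nz ne[THEN not_sym] by (cases d) (auto simp: entry_ratio_def)
  then have "acts_as_translation K w (base_flag d) (longitude K d)"
    unfolding base acts_as_translation_def longitude_def
    using develops_passages[of d w "passages K d"] d passages_return[of d] by simp
  ultimately show "acts_as_translation K w (base_flag d) meridian \<and> acts_as_translation K w (base_flag d) (longitude K d)"
    by blast
qed

end

section \<open>Equivalence of the two systems\<close>

theorem proposition1p1:
  fixes L :: "(complex \<times> complex) set"
    and K :: "'c diagram"
    and w :: "'c region_vars"
    and W :: "'c region_vars \<Rightarrow> complex"
  assumes "hyperbolic_link L"
    and "diagram_of K L"
    and "admissible K w"
    and "potential_function K w W"
  shows "potential_equations K W w \<longleftrightarrow> hyperbolicity_equations K w"
proof -
  interpret link_diagram K
    using assms(2) unfolding diagram_of_def by unfold_locales blast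
  have nd: "nondegenerate K w c" if "c \<in> crossings K" for c
    using assms(3) that by (rule admissible_nondegenerate)
  have "completeness K w"
    using nd by (rule completeness_holds)
  moreover have "potential_equations K W w \<longleftrightarrow> gluing_equations K w"
    using potential_equations_iff[OF nd assms(4)] gluing_equations_iff[OF nd] by simp
  ultimately show ?thesis unfolding hyperbolicity_equations_def by simp
qed

end
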